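(* Let $\mathfrak p=(p,q)\in\mathbb Z_+^2$ be given. There exists a constant $C=C_{\mathfrak p}>0$ such that: (1) If $V$ is $\mathfrak p$-periodic and $\|V\|_\infty\le C$, then $\sigma(H_V)$ has at most two connected components. (2) If at least one of $p$ or $q$ is odd, then $\sigma(H_V)$ is a single (closed) interval whenever $V$ is $\mathfrak p$-periodic and $\|V\|_\infty\le C$.
   Context: For a bounded real-valued function $V:\mathbb Z^2\to\mathbb R$, $H_V=\Delta+V$ is the bounded self-adjoint operator on $\ell^2(\mathbb Z^2)$ given by $[H_V\psi]_{n,m}=\psi_{n-1,m}+\psi_{n+1,m}+\psi_{n,m-1}+\psi_{n,m+1}+V_{n,m}\psi_{n,m}$. $V$ is called $\mathfrak p$-periodic, $\mathfrak p=(p,q)\in\mathbb Z_+^2$, if $V_{n+p,m}=V_{n,m+q}=V_{n,m}$ for all $n,m\in\mathbb Z$. $\|V\|_\infty=\sup_{n,m}|V_{n,m}|$ and $\sigma(\cdot)$ denotes the spectrum. *)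

theory Defs
  imports "HOL-Analysis.Analysis"
begin

definition l2 :: "(int \<times> int \<Rightarrow> complex) set" where
  "l2 = {\<psi>. (\<lambda>x. (cmod (\<psi> x))\<^sup>2) summable_on UNIV}"

definition l2norm :: "(int \<times> int \<Rightarrow> complex) \<Rightarrow> real" where
  "l2norm \<psi> = sqrt (\<Sum>\<^sub>\<infinity>x. (cmod (\<psi> x))\<^sup>2)"

definition schr_op :: "(int \<times> int \<Rightarrow> real) \<Rightarrow> (int \<times> int \<Rightarrow> complex) \<Rightarrow> (int \<times> int \<Rightarrow> complex)" where
  "schr_op V \<psi> = (\<lambda>(n, m). \<psi> (n - 1, m) + \<psi> (n + 1, m) + \<psi> (n, m - 1) + \<psi> (n, m + 1)
                      + complex_of_real (V (n, m)) * \<psi> (n, m))"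

definition resolvent_set :: "(int \<times> int \<Rightarrow> real) \<Rightarrow> complex set" where
  "resolvent_set V = {z. bij_betw (\<lambda>\<psi>. (\<lambda>x. schr_op V \<psi> x - z * \<psi> x)) l2 l2 \<and>
      (\<exists>K. \<forall>\<psi>\<in>l2. l2norm \<psi> \<le> K * l2norm (\<lambda>x. schr_op V \<psi> x - z * \<psi> x))}"

definition spectrum_H :: "(int \<times> int \<Rightarrow> real) \<Rightarrow> complex set" where
  "spectrum_H V = - resolvent_set V"

definition periodic_pq :: "int \<Rightarrow> int \<Rightarrow> (int \<times> int \<Rightarrow> real) \<Rightarrow> bool" where
  "periodic_pq p q V \<longleftrightarrow> (\<forall>n m. V (n + p, m) = V (n, m) \<and> V (n, m + q) = V (n, m))"

end

theory Submission
  imports Defs "Jordan_Normal_Form.Char_Poly"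
begin

text \<open>By Floquet theory the spectrum is the set of real zeros \<open>E\<close> of \<open>det (E - H(a, b))\<close>, where \<open>H(a, b)\<close> is
  the matrix of \<open>H\<^sub>V\<close> on Bloch functions with multipliers \<open>(a, b)\<close> on the torus \<open>\<bar>a\<bar> = \<bar>b\<bar> = 1\<close>. This determinant
  is real for real \<open>E\<close>. For \<open>V = 0\<close> it is the product of \<open>E - 2 cos (x + 2 \<pi> j / p) - 2 cos (y + 2 \<pi> l / q)\<close>
  over all \<open>j\<close> and \<open>l\<close>. For \<open>-4 < E < 4\<close> with \<open>E \<noteq> 0\<close>, a generic point of the zero set lies on only one of the
  translated level curves, so the product changes sign across it; for \<open>E = 0\<close> it changes sign under a suitable
  translation if \<open>p\<close> or \<open>q\<close> is odd. A sign change survives small perturbations, and by the intermediate value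
  theorem such \<open>E\<close> stay in the spectrum, uniformly on compact sets of energies. Near the exceptional energies
  \<open>\<plusminus>4\<close> and possibly \<open>0\<close> the part outside the spectrum is convex: there is a quasimomentum without nearby
  eigenvalues, and for two energies outside the spectrum the set of quasimomenta having an eigenvalue between
  them is open and closed in the connected torus.\<close>

text \<open>Everything passes through the determinant; no ordered band functions occur. Floquet
  theory is proved for the given definition of the spectrum: a Bloch eigenfunction is bounded but
  not square-summable, so it is damped; a nonvanishing determinant yields a uniform lower bound for
  H - z, carried to \<open>l2\<close> by a Parseval identity over roots of unity instead of
  integrals over the torus. The exceptional energies are genuine obstacles to a sign change. At 4
  every free factor is nonnegative, at -4 nonpositive. At 0 with p and q even, the factors pair
  under (j, l) -> (j + p/2, l + q/2) into pq/2 negated squares, an even number, so the free product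
  is never negative. Convexity suffices there: energies of modulus above 4 + C lie outside the
  spectrum, so an energy missing near 4 or -4 belongs to the exterior and not to a gap; near 0 at
  most one gap remains, hence at most two components.\<close>

hide_const (open) Determinants.det Finite_Cartesian_Product.mat Finite_Cartesian_Product.vec
hide_const (open) Finite_Cartesian_Product.row Finite_Cartesian_Product.column

section \<open>Square-summable functions on the lattice\<close>

lemma L2_set_le_l2norm:
  assumes "\<psi> \<in> l2" "finite F"
  shows "L2_set (\<lambda>x. cmod (\<psi> x)) F \<le> l2norm \<psi>"
  using assms unfolding L2_set_def l2norm_def l2_def
  by (auto intro!: finite_sum_le_infsum)

text \<open>Membership and norm bounds reduce to finite sets of sites; Minkowski's inequality for
  \<open>L2_set\<close> thus transfers to infinite sums.\<close>

lemma l2_bounded_L2_set: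
  assumes "\<And>F. finite F \<Longrightarrow> L2_set (\<lambda>x. cmod (\<psi> x)) F \<le> B"
  shows "\<psi> \<in> l2" "l2norm \<psi> \<le> B"
proof -
  have B: "0 \<le> B" using assms[of "{}"] by simp
  have le: "(\<Sum>x\<in>F. (cmod (\<psi> x))\<^sup>2) \<le> B\<^sup>2" if "finite F" for F
    using assms[OF that] B unfolding L2_set_def by (simp add: real_sqrt_le_iff sqrt_le_D)
  have summ: "(\<lambda>x. (cmod (\<psi> x))\<^sup>2) summable_on UNIV"
    by (rule nonneg_bdd_above_summable_on) (auto intro!: bdd_aboveI2 le)
  then show "\<psi> \<in> l2" by (simp add: l2_def)
  have "(\<Sum>\<^sub>\<infinity>x. (cmod (\<psi> x))\<^sup>2) \<le> B\<^sup>2"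
    by (rule infsum_le_finite_sums[OF summ]) (use le in auto)
  then show "l2norm \<psi> \<le> B" unfolding l2norm_def using B by (simp add: real_le_lsqrt)
qed

lemma l2norm_nonneg [simp]: "0 \<le> l2norm \<psi>"
  unfolding l2norm_def by (intro real_sqrt_ge_zero infsum_nonneg) simp

lemma l2norm_square: "(l2norm \<psi>)\<^sup>2 = (\<Sum>\<^sub>\<infinity>x. (cmod (\<psi> x))\<^sup>2)"
  unfolding l2norm_def by (simp add: infsum_nonneg)

lemma cmod_le_l2norm: "\<psi> \<in> l2 \<Longrightarrow> cmod (\<psi> x) \<le> l2norm \<psi>"
  using L2_set_le_l2norm[of \<psi> "{x}"] by simp

lemma l2norm_eq_0D: "\<psi> \<in> l2 \<Longrightarrow> l2norm \<psi> = 0 \<Longrightarrow> \<psi> x = 0"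
  using cmod_le_l2norm[of \<psi> x] by simp

lemma l2_zero [simp]: "(\<lambda>x. 0) \<in> l2" "l2norm (\<lambda>x. 0) = 0"
  by (auto simp: l2_def l2norm_def)

lemma l2_add:
  assumes "\<phi> \<in> l2" "\<eta> \<in> l2"
  shows "(\<lambda>x. \<phi> x + \<eta> x) \<in> l2" "l2norm (\<lambda>x. \<phi> x + \<eta> x) \<le> l2norm \<phi> + l2norm \<eta>"
proof -
  have "L2_set (\<lambda>x. cmod (\<phi> x + \<eta> x)) F \<le> l2norm \<phi> + l2norm \<eta>" if "finite F" for F
  proof -
    have "L2_set (\<lambda>x. cmod (\<phi> x + \<eta> x)) F \<le> L2_set (\<lambda>x. cmod (\<phi> x) + cmod (\<eta> x)) F"
      by (intro L2_set_mono norm_triangle_ineq) auto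
    also have "\<dots> \<le> L2_set (\<lambda>x. cmod (\<phi> x)) F + L2_set (\<lambda>x. cmod (\<eta> x)) F"
      by (rule L2_set_triangle_ineq)
    finally show ?thesis using L2_set_le_l2norm[OF assms(1) that] L2_set_le_l2norm[OF assms(2) that]
      by linarith
  qed
  then show "(\<lambda>x. \<phi> x + \<eta> x) \<in> l2" "l2norm (\<lambda>x. \<phi> x + \<eta> x) \<le> l2norm \<phi> + l2norm \<eta>"
    by (auto intro: l2_bounded_L2_set)
qed

lemma l2_mult_bounded:
  assumes "\<psi> \<in> l2" "\<And>x. cmod (g x) \<le> B * cmod (\<psi> x)" "0 \<le> B"
  shows "g \<in> l2" "l2norm g \<le> B * l2norm \<psi>"
proof -
  have "L2_set (\<lambda>x. cmod (g x)) F \<le> B * l2norm \<psi>" if "finite F" for F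
  proof -
    have "L2_set (\<lambda>x. cmod (g x)) F \<le> L2_set (\<lambda>x. B * cmod (\<psi> x)) F"
      by (intro L2_set_mono assms) auto
    also have "\<dots> = B * L2_set (\<lambda>x. cmod (\<psi> x)) F"
      by (simp add: L2_set_right_distrib assms(3))
    finally show ?thesis
      using mult_left_mono[OF L2_set_le_l2norm[OF assms(1) that] assms(3)] by linarith
  qed
  then show "g \<in> l2" "l2norm g \<le> B * l2norm \<psi>" by (auto intro: l2_bounded_L2_set)
qed

lemma l2_scale:
  assumes "\<psi> \<in> l2"
  shows "(\<lambda>x. c * \<psi> x) \<in> l2" "l2norm (\<lambda>x. c * \<psi> x) = cmod c * l2norm \<psi>"
proof -
  show "(\<lambda>x. c * \<psi> x) \<in> l2" by (rule l2_mult_bounded[OF assms, of _ "cmod c"]) (auto simp: norm_mult)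
  show "l2norm (\<lambda>x. c * \<psi> x) = cmod c * l2norm \<psi>"
    by (simp add: l2norm_def norm_mult power_mult_distrib infsum_cmult_right' real_sqrt_mult)
qed

lemma l2_diff:
  assumes "\<phi> \<in> l2" "\<eta> \<in> l2"
  shows "(\<lambda>x. \<phi> x - \<eta> x) \<in> l2" "l2norm (\<lambda>x. \<phi> x - \<eta> x) \<le> l2norm \<phi> + l2norm \<eta>"
  using l2_add[OF assms(1) l2_scale(1)[OF assms(2), of "-1"]] l2_scale(2)[OF assms(2), of "-1"]
  by simp_all

lemma bij_shift: "bij (\<lambda>x::int \<times> int. x + d)"
  by (rule bij_plus_right)

lemma l2_shift:
  fixes d :: "int \<times> int"
  shows "\<psi> \<in> l2 \<Longrightarrow> (\<lambda>x. \<psi> (x + d)) \<in> l2" "l2norm (\<lambda>x. \<psi> (x + d)) = l2norm \<psi>"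
  using summable_on_reindex_bij_betw[OF bij_shift[of d], of "\<lambda>x. (cmod (\<psi> x))\<^sup>2"]
    infsum_reindex_bij_betw[OF bij_shift[of d], of "\<lambda>x. (cmod (\<psi> x))\<^sup>2"]
  by (auto simp: l2_def l2norm_def)

lemma schr_op_shift:
  "schr_op V \<psi> x = \<psi> (x + (-1,0)) + \<psi> (x + (1,0)) + \<psi> (x + (0,-1)) + \<psi> (x + (0,1))
     + complex_of_real (V x) * \<psi> x"
  by (cases x) (simp add: schr_op_def)

definition schr_sub :: "(int \<times> int \<Rightarrow> real) \<Rightarrow> complex \<Rightarrow> (int \<times> int \<Rightarrow> complex) \<Rightarrow> int \<times> int \<Rightarrow> complex" where
  "schr_sub V z \<psi> = (\<lambda>x. schr_op V \<psi> x - z * \<psi> x)"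

lemma schr_sub_shift:
  "schr_sub V z \<psi> x = \<psi> (x + (-1,0)) + \<psi> (x + (1,0)) + \<psi> (x + (0,-1)) + \<psi> (x + (0,1))
     + (complex_of_real (V x) - z) * \<psi> x"
  by (simp add: schr_sub_def schr_op_shift algebra_simps)

lemma schr_sub_diff:
  "schr_sub V z (\<lambda>x. \<phi> x - \<eta> x) = (\<lambda>x. schr_sub V z \<phi> x - schr_sub V z \<eta> x)"
  by (rule ext) (simp add: schr_sub_shift algebra_simps)

lemma schr_sub_l2:
  assumes V: "\<forall>x. \<bar>V x\<bar> \<le> C" and \<psi>: "\<psi> \<in> l2"
  shows "schr_sub V z \<psi> \<in> l2" "l2norm (schr_sub V z \<psi>) \<le> (4 + C + cmod z) * l2norm \<psi>"
proof -
  have C: "0 \<le> C" using V[rule_format, of 0] by simp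
  have b: "cmod ((complex_of_real (V x) - z) * \<psi> x) \<le> (C + cmod z) * cmod (\<psi> x)" for x
  proof -
    have "cmod (complex_of_real (V x) - z) \<le> cmod (complex_of_real (V x)) + cmod z"
      by (rule norm_triangle_ineq4)
    also have "\<dots> \<le> C + cmod z" using V[rule_format, of x] by simp
    finally show ?thesis by (simp add: norm_mult mult_right_mono)
  qed
  note vz = l2_mult_bounded[OF \<psi> b]
  have vz1: "(\<lambda>x. (complex_of_real (V x) - z) * \<psi> x) \<in> l2"
    and vz2: "l2norm (\<lambda>x. (complex_of_real (V x) - z) * \<psi> x) \<le> (C + cmod z) * l2norm \<psi>"
    using vz C by auto
  note s = l2_shift(1)[OF \<psi>]
  have eq: "schr_sub V z \<psi> = (\<lambda>x. \<psi> (x + (-1,0)) + \<psi> (x + (1,0)) + \<psi> (x + (0,-1)) + \<psi> (x + (0,1))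
     + (complex_of_real (V x) - z) * \<psi> x)" by (rule ext) (rule schr_sub_shift)
  note a1 = l2_add[OF s s, of "(-1,0)" "(1,0)"]
  note a2 = l2_add[OF a1(1) s, of "(0,-1)"]
  note a3 = l2_add[OF a2(1) s, of "(0,1)"]
  note a4 = l2_add[OF a3(1) vz1]
  show "schr_sub V z \<psi> \<in> l2" unfolding eq by (rule a4(1))
  have "l2norm (schr_sub V z \<psi>) \<le> l2norm \<psi> + l2norm \<psi> + l2norm \<psi> + l2norm \<psi> + (C + cmod z) * l2norm \<psi>"
    unfolding eq using a1(2) a2(2) a3(2) a4(2) vz2 by (simp add: l2_shift(2))
  then show "l2norm (schr_sub V z \<psi>) \<le> (4 + C + cmod z) * l2norm \<psi>" by (simp add: algebra_simps)
qed

section \<open>The inner product and the symmetry of the operator\<close>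

definition l2inner :: "(int \<times> int \<Rightarrow> complex) \<Rightarrow> (int \<times> int \<Rightarrow> complex) \<Rightarrow> complex" where
  "l2inner \<phi> \<eta> = (\<Sum>\<^sub>\<infinity>x. \<phi> x * cnj (\<eta> x))"

lemma l2inner_summable:
  assumes "\<phi> \<in> l2" "\<eta> \<in> l2"
  shows "(\<lambda>x. \<phi> x * cnj (\<eta> x)) summable_on UNIV"
proof (rule abs_summable_summable, rule Infinite_Sum.abs_summable_on_comparison_test')
  show "(\<lambda>x. (cmod (\<phi> x))\<^sup>2 + (cmod (\<eta> x))\<^sup>2) summable_on UNIV"
    using assms by (intro summable_on_add) (auto simp: l2_def)
  show "norm (\<phi> x * cnj (\<eta> x)) \<le> (cmod (\<phi> x))\<^sup>2 + (cmod (\<eta> x))\<^sup>2" for x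
  proof -
    have "0 \<le> cmod (\<phi> x) * cmod (\<eta> x)" by simp
    then have "cmod (\<phi> x) * cmod (\<eta> x) \<le> (cmod (\<phi> x))\<^sup>2 + (cmod (\<eta> x))\<^sup>2"
      using sum_squares_bound[of "cmod (\<phi> x)" "cmod (\<eta> x)"] by linarith
    then show ?thesis by (simp add: norm_mult)
  qed
qed

lemma l2inner_self: "l2inner \<phi> \<phi> = of_real ((l2norm \<phi>)\<^sup>2)"
proof (cases "(\<lambda>x. (cmod (\<phi> x))\<^sup>2) summable_on UNIV")
  case True
  then have "((\<lambda>x. complex_of_real ((cmod (\<phi> x))\<^sup>2)) has_sum of_real ((l2norm \<phi>)\<^sup>2)) UNIV"
    unfolding l2norm_square by (intro has_sum_of_real) simp
  then show ?thesis unfolding l2inner_def complex_norm_square by (rule infsumI)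
next
  \<comment> \<open>Outside \<open>l2\<close> both sides are 0, the default value of a divergent
    \<open>infsum\<close>.\<close>
  case False
  then have "\<not> (\<lambda>x. \<phi> x * cnj (\<phi> x)) summable_on UNIV"
    using summable_on_Re by (fastforce simp: complex_norm_square[symmetric])
  with False show ?thesis unfolding l2inner_def l2norm_square by (simp add: infsum_not_exists)
qed

lemma l2inner_cnj: "l2inner \<phi> \<eta> = cnj (l2inner \<eta> \<phi>)"
  unfolding l2inner_def infsum_cnj[symmetric] by (simp add: mult.commute)

lemma l2inner_add:
  assumes "\<phi> \<in> l2" "\<phi>' \<in> l2" "\<eta> \<in> l2"
  shows "l2inner (\<lambda>x. \<phi> x + \<phi>' x) \<eta> = l2inner \<phi> \<eta> + l2inner \<phi>' \<eta>"
  unfolding l2inner_def using assms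
  by (simp add: distrib_right infsum_add l2inner_summable)

lemma l2inner_scale: "l2inner (\<lambda>x. c * \<phi> x) \<eta> = c * l2inner \<phi> \<eta>"
  unfolding l2inner_def by (simp add: mult.assoc infsum_cmult_right')

lemma l2inner_scale_right: "l2inner \<phi> (\<lambda>x. c * \<eta> x) = cnj c * l2inner \<phi> \<eta>"
  by (subst l2inner_cnj, subst (2) l2inner_cnj) (simp add: l2inner_scale)

lemma l2norm_diff_square:
  assumes "\<phi> \<in> l2" "\<eta> \<in> l2"
  shows "(l2norm (\<lambda>x. \<phi> x - \<eta> x))\<^sup>2 = (l2norm \<phi>)\<^sup>2 - 2 * Re (l2inner \<phi> \<eta>) + (l2norm \<eta>)\<^sup>2"
proof -
  have 1: "(\<lambda>x. \<phi> x - \<eta> x) = (\<lambda>x. \<phi> x + (-1) * \<eta> x)" by simp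
  have [simp]: "(\<lambda>x. - \<eta> x) \<in> l2" using l2_scale(1)[OF assms(2), of "-1"] by simp
  have d: "(\<lambda>x. \<phi> x - \<eta> x) \<in> l2" using assms by (rule l2_diff)
  have "of_real ((l2norm (\<lambda>x. \<phi> x - \<eta> x))\<^sup>2) = l2inner (\<lambda>x. \<phi> x - \<eta> x) (\<lambda>x. \<phi> x - \<eta> x)"
    by (simp add: l2inner_self)
  also have "\<dots> = l2inner \<phi> (\<lambda>x. \<phi> x - \<eta> x) - l2inner \<eta> (\<lambda>x. \<phi> x - \<eta> x)"
    using l2inner_add[OF assms(1) l2_scale(1)[OF assms(2), of "-1"] d] l2inner_scale[of "-1" \<eta>] by simp
  also have "l2inner \<phi> (\<lambda>x. \<phi> x - \<eta> x) = cnj (l2inner \<phi> \<phi> - l2inner \<eta> \<phi>)"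
    using l2inner_add[OF assms(1) l2_scale(1)[OF assms(2), of "-1"] assms(1)] l2inner_scale[of "-1" \<eta>]
    by (subst l2inner_cnj) simp
  also have "l2inner \<eta> (\<lambda>x. \<phi> x - \<eta> x) = cnj (l2inner \<phi> \<eta> - l2inner \<eta> \<eta>)"
    using l2inner_add[OF assms(1) l2_scale(1)[OF assms(2), of "-1"] assms(2)] l2inner_scale[of "-1" \<eta>]
    by (subst l2inner_cnj) simp
  finally have "Re (of_real ((l2norm (\<lambda>x. \<phi> x - \<eta> x))\<^sup>2))
    = Re (cnj (l2inner \<phi> \<phi> - l2inner \<eta> \<phi>) - cnj (l2inner \<phi> \<eta> - l2inner \<eta> \<eta>))" by simp
  then show ?thesis using arg_cong[OF l2inner_cnj[of \<phi> \<eta>], of Re] by (simp add: l2inner_self)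
qed

lemma l2inner_shift:
  fixes d :: "int \<times> int"
  shows "l2inner (\<lambda>x. \<phi> (x + d)) \<eta> = l2inner \<phi> (\<lambda>x. \<eta> (x + (- d)))"
  unfolding l2inner_def
  using infsum_reindex_bij_betw[OF bij_shift[of d], of "\<lambda>x. \<phi> x * cnj (\<eta> (x - d))"] by simp

text \<open>The adjoint of a shift is the opposite shift, and the four shifts are closed under
  reversal; V is real, so only z is conjugated.\<close>

lemma schr_sub_adjoint:
  assumes V: "\<forall>x. \<bar>V x\<bar> \<le> C" and "\<phi> \<in> l2" "\<eta> \<in> l2"
  shows "l2inner (schr_sub V z \<phi>) \<eta> = l2inner \<phi> (schr_sub V (cnj z) \<eta>)"
proof -
  note s = l2_shift(1)[OF assms(2)] l2_shift(1)[OF assms(3)]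
  have w: "(\<lambda>x. (complex_of_real (V x) - z) * \<psi> x) \<in> l2" if "\<psi> \<in> l2" for \<psi> z
  proof (rule l2_mult_bounded(1)[OF that, of _ "C + cmod z"])
    fix x
    have "cmod (complex_of_real (V x) - z) \<le> cmod (complex_of_real (V x)) + cmod z"
      by (rule norm_triangle_ineq4)
    also have "\<dots> \<le> C + cmod z" using V[rule_format, of x] by simp
    finally show "cmod ((complex_of_real (V x) - z) * \<psi> x) \<le> (C + cmod z) * cmod (\<psi> x)"
      by (simp add: norm_mult mult_right_mono)
  next
    show "0 \<le> C + cmod z" using V[rule_format, of 0] by (simp add: add_nonneg_nonneg order_trans[OF abs_ge_zero])
  qed
  have exp: "l2inner (schr_sub V z \<phi>) \<eta> = l2inner (\<lambda>x. \<phi> (x + (-1,0))) \<eta> + l2inner (\<lambda>x. \<phi> (x + (1,0))) \<eta>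
      + l2inner (\<lambda>x. \<phi> (x + (0,-1))) \<eta> + l2inner (\<lambda>x. \<phi> (x + (0,1))) \<eta>
      + l2inner (\<lambda>x. (complex_of_real (V x) - z) * \<phi> x) \<eta>" if "\<phi> \<in> l2" "\<eta> \<in> l2" for \<phi> \<eta> z
  proof -
    have eq: "schr_sub V z \<phi> = (\<lambda>x. \<phi> (x + (-1,0)) + \<phi> (x + (1,0)) + \<phi> (x + (0,-1)) + \<phi> (x + (0,1))
     + (complex_of_real (V x) - z) * \<phi> x)" by (rule ext) (rule schr_sub_shift)
    show ?thesis unfolding eq using that by (simp add: l2inner_add l2_add l2_shift w)
  qed
  have p: "l2inner (\<lambda>x. (complex_of_real (V x) - z) * \<phi> x) \<eta>
     = cnj (l2inner (\<lambda>x. (complex_of_real (V x) - cnj z) * \<eta> x) \<phi>)"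
    unfolding l2inner_def infsum_cnj[symmetric] by (simp add: mult_ac)
  have q: "l2inner (\<lambda>x. \<phi> (x + d)) \<eta> = cnj (l2inner (\<lambda>x. \<eta> (x + (- d))) \<phi>)" for d
    by (simp add: l2inner_shift l2inner_cnj[symmetric])
  show ?thesis
    by (subst exp[OF assms(2,3)], subst (6) l2inner_cnj, subst exp[OF assms(3,2)]) (simp add: p q)
qed

text \<open>Pythagoras: H - Re z is symmetric, so its quadratic form is real and the cross term with
  the multiple i Im z of the function has no real part. In particular H - z is bounded below by the
  modulus of Im z.\<close>

lemma l2norm_schr_sub_square:
  assumes V: "\<forall>x. \<bar>V x\<bar> \<le> C" and \<phi>: "\<phi> \<in> l2"
  shows "(l2norm (schr_sub V z \<phi>))\<^sup>2 = (l2norm (schr_sub V (of_real (Re z)) \<phi>))\<^sup>2 + (Im z)\<^sup>2 * (l2norm \<phi>)\<^sup>2"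
proof -
  let ?h = "schr_sub V (of_real (Re z)) \<phi>"
  have h: "?h \<in> l2" by (rule schr_sub_l2(1)[OF V \<phi>])
  have eq: "schr_sub V z \<phi> = (\<lambda>x. ?h x - (\<i> * complex_of_real (Im z)) * \<phi> x)"
    by (rule ext) (simp add: schr_sub_def algebra_simps complex_eq_iff)
  have "cnj (l2inner ?h \<phi>) = l2inner ?h \<phi>"
    using schr_sub_adjoint[OF V \<phi> \<phi>, where z = "of_real (Re z)"]
    unfolding complex_cnj_complex_of_real l2inner_cnj[of \<phi> ?h] by (rule sym)
  then have "Im (l2inner ?h \<phi>) = 0" by (simp add: complex_eq_iff)
  then have "Re (l2inner ?h (\<lambda>x. (\<i> * complex_of_real (Im z)) * \<phi> x)) = 0" by (simp only: l2inner_scale_right) simp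
  then show ?thesis unfolding eq l2norm_diff_square[OF h l2_scale(1)[OF \<phi>]]
    by (simp add: l2_scale(2)[OF \<phi>] norm_mult power_mult_distrib)
qed

section \<open>Bounded eigenfunctions and resolvents\<close>

lemma summable_on_exp_abs_int:
  assumes "0 < (e::real)"
  shows "(\<lambda>n::int. exp (- e * \<bar>real_of_int n\<bar>)) summable_on UNIV"
proof -
  let ?f = "\<lambda>n::int. exp (- e * \<bar>real_of_int n\<bar>)"
  have "summable (\<lambda>n. exp (- e) ^ n)" using assms by (intro summable_geometric) auto
  then have 1: "(\<lambda>n. exp (- e) ^ n) summable_on (UNIV :: nat set)"
    by (intro summable_nonneg_imp_summable_on) auto
  have pw: "exp (- e) ^ n = exp (- e * real n)" for n
    by (metis exp_of_nat_mult mult.commute)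
  have "?f summable_on range int"
    using 1 by (subst summable_on_reindex) (auto simp: o_def pw inj_on_def)
  moreover have "?f summable_on range (\<lambda>n. - int n)"
    using 1 by (subst summable_on_reindex) (auto simp: o_def pw inj_on_def)
  moreover have "(UNIV :: int set) = range int \<union> range (\<lambda>n. - int n)"
    by (metis (mono_tags) UNIV_eq_I UnI1 UnI2 int_cases2 rangeI)
  ultimately show ?thesis using summable_on_union by metis
qed

lemma summable_on_exp_abs_int2:
  assumes "0 < (e::real)"
  shows "(\<lambda>x::int \<times> int. exp (- e * (\<bar>real_of_int (fst x)\<bar> + \<bar>real_of_int (snd x)\<bar>))) summable_on UNIV"
proof -
  define f where "f n = exp (- e * \<bar>real_of_int n\<bar>)" for n :: int
  have s: "f summable_on UNIV" unfolding f_def by (rule summable_on_exp_abs_int[OF assms])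
  have f0: "0 \<le> f n" for n by (simp add: f_def)
  have "(\<lambda>x. f (fst x) * f (snd x)) summable_on UNIV \<times> UNIV"
  proof (rule summable_on_SigmaI)
    show "((\<lambda>m. f (fst (n, m)) * f (snd (n, m))) has_sum f n * infsum f UNIV) UNIV" for n
      using s by (auto intro: has_sum_cmult_right)
    show "(\<lambda>n. f n * infsum f UNIV) summable_on UNIV"
      using s by (rule summable_on_cmult_left)
  qed (simp add: f0)
  then show ?thesis
    by (simp add: f_def exp_add[symmetric] ring_distribs)
qed

text \<open>Damping a bounded generalised eigenfunction by \<open>exp (- e (\<bar>n\<bar> + \<bar>m\<bar>))\<close>
  gives an approximate eigenfunction in \<open>\<ell>\<^sup>2\<close>.\<close>

lemma bounded_eigenfunction_approx:
  assumes B: "\<And>x. cmod (\<psi> x) \<le> B" and nz: "\<psi> x0 \<noteq> 0"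
    and eig: "\<And>x. schr_op V \<psi> x = z * \<psi> x" and e: "0 < e"
  obtains \<phi> where "\<phi> \<in> l2" "0 < l2norm \<phi>"
    "l2norm (schr_sub V z \<phi>) \<le> 4 * (exp e - 1) * l2norm \<phi>"
proof -
  define h :: "int \<times> int \<Rightarrow> real" where "h x = \<bar>real_of_int (fst x)\<bar> + \<bar>real_of_int (snd x)\<bar>" for x
  define w where "w x = exp (- e * h x)" for x
  define \<phi> where "\<phi> x = \<psi> x * complex_of_real (w x)" for x
  define k where "k = exp e - 1"
  have k: "0 \<le> k" using e by (simp add: k_def)
  have B0: "0 \<le> B" using B[of 0] norm_ge_zero order_trans by blast
  have \<phi>: "\<phi> \<in> l2"
  proof -
    have "(\<lambda>x. B\<^sup>2 * exp (- (2 * e) * h x)) summable_on UNIV"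
      unfolding h_def
      by (rule summable_on_cmult_right[OF summable_on_exp_abs_int2]) (use e in simp)
    then show ?thesis unfolding l2_def mem_Collect_eq
    proof (rule summable_on_comparison_test)
      fix x
      have "(cmod (\<phi> x))\<^sup>2 = (cmod (\<psi> x))\<^sup>2 * exp (- (2 * e) * h x)"
        by (simp add: \<phi>_def norm_mult power_mult_distrib w_def exp_double[symmetric] mult_ac)
      also have "\<dots> \<le> B\<^sup>2 * exp (- (2 * e) * h x)" by (intro mult_right_mono power_mono B) auto
      finally show "(cmod (\<phi> x))\<^sup>2 \<le> B\<^sup>2 * exp (- (2 * e) * h x)" .
    qed auto
  qed
  have "\<phi> x0 \<noteq> 0" using nz by (simp add: \<phi>_def w_def)
  then have pos: "0 < l2norm \<phi>" using cmod_le_l2norm[OF \<phi>, of x0]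
    by (meson less_le_trans zero_less_norm_iff)
  \<comment> \<open>\<open>g d\<close> is the part of the commutator of H with multiplication by
    \<open>w\<close> that comes from the neighbour d. The diagonal part commutes, and the remaining
    term vanishes by the eigenvalue equation.\<close>
  define g where "g d x = \<psi> (x + d) * complex_of_real (w (x + d) - w x)" for d x
  have g: "g d \<in> l2 \<and> l2norm (g d) \<le> k * l2norm \<phi>"
    if d: "d \<in> {(-1,0), (1,0), (0,-1), (0,1)}" for d
  proof -
    have "\<bar>w (x + d) - w x\<bar> \<le> k * w (x + d)" for x
    proof -
      have hd: "\<bar>h (x + d) - h x\<bar> \<le> 1" using d by (auto simp: h_def)
      define r where "r = e * (h (x + d) - h x)"
      have r: "\<bar>r\<bar> \<le> e" using hd e by (simp add: r_def abs_mult mult_left_le)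
      have wx: "w x = exp r * w (x + d)" unfolding w_def r_def exp_add[symmetric] by (simp add: algebra_simps)
      have "\<bar>1 - exp r\<bar> \<le> k"
      proof -
        have "exp r \<le> exp e" "exp (- e) \<le> exp r" using r by auto
        \<comment> \<open>This gives 1 - exp (-e) \<le> exp e - 1, so the same k covers negative
          r.\<close>
        moreover have "1 + 1 \<le> exp e + exp (- e)"
          using exp_ge_add_one_self[of e] exp_ge_add_one_self[of "-e"] by linarith
        ultimately show ?thesis unfolding k_def by linarith
      qed
      then have "\<bar>(1 - exp r) * w (x + d)\<bar> \<le> k * w (x + d)"
        unfolding abs_mult by (intro mult_mono) (auto simp: w_def k)
      then show ?thesis unfolding wx by (simp add: algebra_simps)
    qed
    note wk = this
    have "cmod (g d x) \<le> k * cmod (\<phi> (x + d))" for x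
    proof -
      have "cmod (g d x) = cmod (\<psi> (x + d)) * \<bar>w (x + d) - w x\<bar>"
        unfolding g_def norm_mult norm_of_real ..
      also have "\<dots> \<le> cmod (\<psi> (x + d)) * (k * w (x + d))" by (intro mult_left_mono wk) simp
      also have "\<dots> = k * cmod (\<phi> (x + d))" by (simp add: \<phi>_def norm_mult w_def)
      finally show ?thesis .
    qed
    from l2_mult_bounded[OF l2_shift(1)[OF \<phi>] this k] show ?thesis
      by (simp add: l2_shift(2))
  qed
  have eq: "schr_sub V z \<phi> = (\<lambda>x. g (-1,0) x + g (1,0) x + g (0,-1) x + g (0,1) x)"
  proof (rule ext)
    fix x
    have "schr_sub V z \<phi> x = g (-1,0) x + g (1,0) x + g (0,-1) x + g (0,1) x + w x * schr_sub V z \<psi> x"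
      unfolding schr_sub_shift g_def \<phi>_def by (simp add: algebra_simps)
    then show "schr_sub V z \<phi> x = g (-1,0) x + g (1,0) x + g (0,-1) x + g (0,1) x"
      by (simp add: schr_sub_def eig)
  qed
  note g' = g[THEN conjunct1] g[THEN conjunct2]
  note a1 = l2_add[OF g'(1) g'(1), of "(-1,0)" "(1,0)"]
  note a2 = l2_add[OF a1(1) g'(1), of "(0,-1)"]
  note a3 = l2_add[OF a2(1) g'(1), of "(0,1)"]
  have "l2norm (schr_sub V z \<phi>) \<le> 4 * k * l2norm \<phi>"
    unfolding eq using a1(2) a2(2) a3(2) g'(2)[of "(-1,0)"] g'(2)[of "(1,0)"] g'(2)[of "(0,-1)"] g'(2)[of "(0,1)"]
    by simp
  then show thesis using that \<phi> pos k_def by blast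
qed

lemma bounded_eigenfunction_spectrum:
  assumes B: "\<And>x. cmod (\<psi> x) \<le> B" and nz: "\<psi> x0 \<noteq> 0"
    and eig: "\<And>x. schr_op V \<psi> x = z * \<psi> x"
  shows "z \<in> spectrum_H V"
proof (rule ccontr)
  assume "z \<notin> spectrum_H V"
  then obtain K where K: "\<And>\<psi>. \<psi> \<in> l2 \<Longrightarrow> l2norm \<psi> \<le> K * l2norm (schr_sub V z \<psi>)"
    unfolding spectrum_H_def resolvent_set_def schr_sub_def by auto
  \<comment> \<open>K might not be positive. Below, e is tuned so that 4 (exp e - 1) L = 1/2, which
    the resolvent bound cannot tolerate.\<close>
  define L where "L = max K 1"
  have L: "0 < L" "K \<le> L" by (auto simp: L_def)
  define e where "e = ln (1 + 1 / (8 * L))"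
  have e: "0 < e" "exp e - 1 = 1 / (8 * L)" using L by (auto simp: e_def add_pos_pos)
  obtain \<phi> where \<phi>: "\<phi> \<in> l2" "0 < l2norm \<phi>" "l2norm (schr_sub V z \<phi>) \<le> 4 * (exp e - 1) * l2norm \<phi>"
    by (rule bounded_eigenfunction_approx[OF B nz eig e(1)])
  have "l2norm \<phi> \<le> L * l2norm (schr_sub V z \<phi>)"
    using K[OF \<phi>(1)] mult_right_mono[OF L(2) l2norm_nonneg] order_trans by blast
  also have "\<dots> \<le> L * (4 * (exp e - 1) * l2norm \<phi>)" by (rule mult_left_mono[OF \<phi>(3)]) (use L in simp)
  also have "\<dots> = l2norm \<phi> / 2" unfolding e(2) using L by simp
  finally show False using \<phi>(2) by simp
qed

text \<open>The damped function would be an approximate eigenfunction at a nonreal z, against the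
  lower bound by the modulus of Im z. This yields real Floquet eigenvalues without inspecting the
  matrices for Hermitian symmetry.\<close>

lemma bounded_eigenfunction_real:
  assumes V: "\<forall>x. \<bar>V x\<bar> \<le> C" and B: "\<And>x. cmod (\<psi> x) \<le> B" and nz: "\<psi> x0 \<noteq> 0"
    and eig: "\<And>x. schr_op V \<psi> x = z * \<psi> x"
  shows "Im z = 0"
proof (rule ccontr)
  assume im: "Im z \<noteq> 0"
  define e where "e = ln (1 + \<bar>Im z\<bar> / 8)"
  have e: "0 < e" "exp e - 1 = \<bar>Im z\<bar> / 8" using im by (auto simp: e_def add_pos_nonneg)
  obtain \<phi> where \<phi>: "\<phi> \<in> l2" "0 < l2norm \<phi>" "l2norm (schr_sub V z \<phi>) \<le> 4 * (exp e - 1) * l2norm \<phi>"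
    by (rule bounded_eigenfunction_approx[OF B nz eig e(1)])
  have "(\<bar>Im z\<bar> * l2norm \<phi>)\<^sup>2 \<le> (l2norm (schr_sub V z \<phi>))\<^sup>2"
    using l2norm_schr_sub_square[OF V \<phi>(1), of z] by (simp add: power_mult_distrib)
  then have "\<bar>Im z\<bar> * l2norm \<phi> \<le> l2norm (schr_sub V z \<phi>)" by (rule power2_le_imp_le) simp
  also have "\<dots> \<le> \<bar>Im z\<bar> * l2norm \<phi> / 2" using \<phi>(3) unfolding e(2) by simp
  finally show False using \<phi>(2) im by (simp add: mult_le_0_iff)
qed

text \<open>The operator norm is at most 4 + C; the bound survives damping because the error d is
  arbitrary.\<close>

lemma bounded_eigenfunction_bound:
  assumes V: "\<forall>x. \<bar>V x\<bar> \<le> C" and B: "\<And>x. cmod (\<psi> x) \<le> B" and nz: "\<psi> x0 \<noteq> 0"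
    and eig: "\<And>x. schr_op V \<psi> x = z * \<psi> x"
  shows "cmod z \<le> 4 + C"
proof (rule field_le_epsilon)
  fix d :: real assume d: "0 < d"
  define e where "e = ln (1 + d / 4)"
  have e: "0 < e" "exp e - 1 = d / 4" using d by (auto simp: e_def add_pos_nonneg)
  obtain \<phi> where \<phi>: "\<phi> \<in> l2" "0 < l2norm \<phi>" "l2norm (schr_sub V z \<phi>) \<le> 4 * (exp e - 1) * l2norm \<phi>"
    by (rule bounded_eigenfunction_approx[OF B nz eig e(1)])
  have "cmod z * l2norm \<phi> = l2norm (\<lambda>x. z * \<phi> x)" by (simp add: l2_scale(2)[OF \<phi>(1)])
  also have "(\<lambda>x. z * \<phi> x) = (\<lambda>x. schr_sub V 0 \<phi> x - schr_sub V z \<phi> x)"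
    by (simp add: schr_sub_def)
  also have "l2norm \<dots> \<le> l2norm (schr_sub V 0 \<phi>) + l2norm (schr_sub V z \<phi>)"
    by (intro l2_diff(2) schr_sub_l2(1)[OF V \<phi>(1)])
  also have "\<dots> \<le> (4 + C) * l2norm \<phi> + d * l2norm \<phi>"
    using schr_sub_l2(2)[OF V \<phi>(1), of 0] \<phi>(3) unfolding e(2) by simp
  also have "\<dots> = (4 + C + d) * l2norm \<phi>" by (simp add: algebra_simps)
  finally show "cmod z \<le> 4 + C + d" using \<phi>(2) by simp
qed

text \<open>With \<open>A = H - z\<close>, the equation \<open>A\<^sup>* A \<psi> = A\<^sup>* f\<close> is solved by the Neumann series of the
  contraction \<open>1 - t A\<^sup>* A\<close>; injectivity of \<open>A\<^sup>*\<close> then gives \<open>A \<psi> = f\<close>.\<close>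

lemma resolvent_setI:
  assumes V: "\<forall>x. \<bar>V x\<bar> \<le> C" and c: "0 < c"
    and lower: "\<And>\<psi>. \<psi> \<in> l2 \<Longrightarrow> c * l2norm \<psi> \<le> l2norm (schr_sub V z \<psi>)"
    and lower': "\<And>\<psi>. \<psi> \<in> l2 \<Longrightarrow> c * l2norm \<psi> \<le> l2norm (schr_sub V (cnj z) \<psi>)"
  shows "z \<in> resolvent_set V"
proof -
  let ?A = "schr_sub V z" and ?A' = "schr_sub V (cnj z)"
  note l2A = schr_sub_l2(1)[OF V]
  have C0: "0 \<le> C" using V[rule_format, of 0] by (rule order_trans[OF abs_ge_zero])
  have bdd: "\<exists>K. \<forall>\<psi>\<in>l2. l2norm \<psi> \<le> K * l2norm (?A \<psi>)"
    using lower c by (intro exI[of _ "1/c"]) (simp add: field_simps)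
  have zero: "\<psi> = (\<lambda>x. 0)" if "\<psi> \<in> l2" "B \<psi> = (\<lambda>x. 0)" "c * l2norm \<psi> \<le> l2norm (B \<psi>)" for \<psi> B
  proof -
    have "c * l2norm \<psi> \<le> 0" using that by simp
    then have "l2norm \<psi> = 0" using c l2norm_nonneg[of \<psi>] by (simp add: mult_le_0_iff)
    then show ?thesis using l2norm_eq_0D[OF that(1)] by blast
  qed
  have inj: "inj_on ?A l2"
  proof (rule inj_onI)
    fix \<phi> \<eta> assume *: "\<phi> \<in> l2" "\<eta> \<in> l2" "?A \<phi> = ?A \<eta>"
    have d: "(\<lambda>x. \<phi> x - \<eta> x) \<in> l2" by (rule l2_diff(1)[OF *(1,2)])
    have "(\<lambda>x. \<phi> x - \<eta> x) = (\<lambda>x. 0)"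
      by (rule zero[OF d, of ?A]) (use lower[OF d] * in \<open>auto simp: schr_sub_diff\<close>)
    then show "\<phi> = \<eta>" by (metis eq_iff_diff_eq_0 ext)
  qed
  have surj: "\<exists>\<psi>\<in>l2. ?A \<psi> = f" if f: "f \<in> l2" for f
  proof -
    define M where "M = 4 + C + cmod z"
    have M: "0 < M" unfolding M_def using C0 by (smt (verit) norm_ge_zero)
    have M': "l2norm (?A' \<psi>) \<le> M * l2norm \<psi>" if "\<psi> \<in> l2" for \<psi>
      using schr_sub_l2(2)[OF V that, of "cnj z"] by (simp add: M_def)
    \<comment> \<open>With this t the quadratic term t^2 M^2 a cancels half of -2 t a, leaving -t a,
      where a is the squared norm of A applied to the function.\<close>
    define t where "t = 1 / M\<^sup>2"
    have t: "0 < t" using M by (simp add: t_def)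
    define T where "T \<phi> = (\<lambda>x. \<phi> x - of_real t * ?A' (?A \<phi>) x)" for \<phi>
    \<comment> \<open>\<open>max 0\<close> keeps q^2 above 1 - t c^2 even if the latter is
      negative.\<close>
    define q where "q = sqrt (max 0 (1 - t * c\<^sup>2))"
    have q: "0 \<le> q" "q < 1" using t c by (auto simp: q_def)
    have T2: "T \<phi> \<in> l2" if "\<phi> \<in> l2" for \<phi>
      unfolding T_def by (intro l2_diff(1) l2_scale(1) l2A that)
    have Tq: "l2norm (T \<phi>) \<le> q * l2norm \<phi>" if \<phi>: "\<phi> \<in> l2" for \<phi>
    proof -
      let ?a = "(l2norm (?A \<phi>))\<^sup>2"
      have "l2inner \<phi> (?A' (?A \<phi>)) = of_real ?a"
        using schr_sub_adjoint[OF V \<phi> l2A[OF \<phi>], of z z] by (simp add: l2inner_self)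
      then have re: "Re (l2inner \<phi> (\<lambda>x. of_real t * ?A' (?A \<phi>) x)) = t * ?a"
        by (simp only: l2inner_scale_right) simp
      have "(l2norm (T \<phi>))\<^sup>2 = (l2norm \<phi>)\<^sup>2 - 2 * (t * ?a) + t\<^sup>2 * (l2norm (?A' (?A \<phi>)))\<^sup>2"
        unfolding T_def l2norm_diff_square[OF \<phi> l2_scale(1)[OF l2A[OF l2A[OF \<phi>]]]] re
          l2_scale(2)[OF l2A[OF l2A[OF \<phi>]]] by (simp add: power_mult_distrib)
      also have "(l2norm (?A' (?A \<phi>)))\<^sup>2 \<le> (M * l2norm (?A \<phi>))\<^sup>2"
        by (intro power_mono M' l2A \<phi> l2norm_nonneg)
      also have "(l2norm \<phi>)\<^sup>2 - 2 * (t * ?a) + t\<^sup>2 * (M * l2norm (?A \<phi>))\<^sup>2 = (l2norm \<phi>)\<^sup>2 - t * ?a"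
        using M unfolding t_def by (simp add: field_simps power2_eq_square)
      also have "\<dots> \<le> (l2norm \<phi>)\<^sup>2 - t * (c * l2norm \<phi>)\<^sup>2"
        using t c by (intro diff_left_mono mult_left_mono power_mono lower[OF \<phi>]) auto
      also have "\<dots> = (1 - t * c\<^sup>2) * (l2norm \<phi>)\<^sup>2" by (simp add: power_mult_distrib algebra_simps)
      also have "\<dots> \<le> q\<^sup>2 * (l2norm \<phi>)\<^sup>2" by (intro mult_right_mono) (auto simp: q_def)
      finally have "(l2norm (T \<phi>))\<^sup>2 \<le> (q * l2norm \<phi>)\<^sup>2" using t
        by (simp add: power_mult_distrib)
      then show ?thesis by (rule power2_le_imp_le) (use q in simp)
    qed
    \<comment> \<open>The equation to be solved is \<psi> = T \<psi> + g, whose Neumann series is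
      summed below.\<close>
    define g where "g = (\<lambda>x. of_real t * ?A' f x)"
    have g: "g \<in> l2" unfolding g_def by (intro l2_scale(1) l2A f)
    have it: "(T ^^ n) g \<in> l2 \<and> l2norm ((T ^^ n) g) \<le> q ^ n * l2norm g" for n
    proof (induction n)
      case (Suc n)
      have "l2norm (T ((T ^^ n) g)) \<le> q * (q ^ n * l2norm g)"
        using Tq[of "(T ^^ n) g"] Suc mult_left_mono[OF _ q(1)] order_trans by blast
      then show ?case using Suc T2 by (simp add: mult.assoc)
    qed (use g in simp)
    define S where "S n x = (\<Sum>k<n. (T ^^ k) g x)" for n x
    have S: "S n \<in> l2 \<and> l2norm (S n) \<le> (\<Sum>k<n. q ^ k * l2norm g)" for n
    proof (induction n)
      case 0 then show ?case by (simp add: S_def[abs_def])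
    next
      case (Suc n)
      have eq: "S (Suc n) = (\<lambda>x. S n x + (T ^^ n) g x)" by (simp add: S_def[abs_def])
      show ?case unfolding eq using l2_add[of "S n" "(T ^^ n) g"] Suc it[of n] by force
    qed
    have geo: "(\<Sum>k<n. q ^ k * l2norm g) \<le> l2norm g / (1 - q)" for n
    proof -
      have "(\<Sum>k<n. q ^ k) \<le> 1 / (1 - q)"
        using sum_le_suminf[OF summable_geometric, of q "{..<n}"] q by (simp add: suminf_geometric)
      then have "(\<Sum>k<n. q ^ k) * l2norm g \<le> 1 / (1 - q) * l2norm g" by (intro mult_right_mono) auto
      then show ?thesis by (simp add: sum_distrib_right)
    qed
    define \<psi> where "\<psi> x = (\<Sum>k. (T ^^ k) g x)" for x
    have lim: "(\<lambda>n. S n x) \<longlonglongrightarrow> \<psi> x" for x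
    proof -
      have "summable (\<lambda>k. (T ^^ k) g x)"
      proof (rule summable_comparison_test')
        show "summable (\<lambda>k. q ^ k * l2norm g)" using q by (intro summable_mult2 summable_geometric) auto
        show "norm ((T ^^ k) g x) \<le> q ^ k * l2norm g" for k
          using cmod_le_l2norm[of "(T ^^ k) g" x] it[of k] by linarith
      qed
      then show ?thesis unfolding S_def \<psi>_def by (rule summable_LIMSEQ)
    qed
    \<comment> \<open>A Fatou argument: on each finite set the partial sums converge and their norms
      are bounded by the geometric series.\<close>
    have \<psi>: "\<psi> \<in> l2"
    proof (rule l2_bounded_L2_set(1))
      fix F :: "(int \<times> int) set" assume F: "finite F"
      have "(\<lambda>n. L2_set (\<lambda>x. cmod (S n x)) F) \<longlonglongrightarrow> L2_set (\<lambda>x. cmod (\<psi> x)) F"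
        unfolding L2_set_def by (intro tendsto_intros lim)
      moreover have "L2_set (\<lambda>x. cmod (S n x)) F \<le> l2norm g / (1 - q)" for n
        using L2_set_le_l2norm[OF _ F, of "S n"] S[of n] geo[of n] by linarith
      ultimately show "L2_set (\<lambda>x. cmod (\<psi> x)) F \<le> l2norm g / (1 - q)"
        by (intro LIMSEQ_le_const2) auto
    qed
    \<comment> \<open>Pointwise convergence is enough, since each value of H - z involves only five
      sites.\<close>
    have limA: "(\<lambda>n. schr_sub V w (u n) x) \<longlonglongrightarrow> schr_sub V w v x" if "\<And>x. (\<lambda>n. u n x) \<longlonglongrightarrow> v x" for u v w x
      unfolding schr_sub_shift by (intro tendsto_intros that)
    have TS: "T (S n) x = S (Suc n) x - g x" for n x
    proof -
      have lin: "schr_sub V w (\<lambda>x. \<Sum>k<n. u k x) = (\<lambda>x. \<Sum>k<n. schr_sub V w (u k) x)" for w u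
        by (rule ext) (simp add: schr_sub_shift sum.distrib sum_distrib_left)
      have "T (S n) x = (\<Sum>k<n. T ((T ^^ k) g) x)"
        unfolding T_def S_def[abs_def] lin by (simp add: sum_subtractf sum_distrib_left)
      also have "\<dots> = S (Suc n) x - g x"
        unfolding S_def by (subst sum.lessThan_Suc_shift) simp
      finally show ?thesis .
    qed
    have "(\<lambda>n. T (S n) x) \<longlonglongrightarrow> T \<psi> x" for x
      unfolding T_def by (intro tendsto_intros lim limA)
    moreover have "(\<lambda>n. T (S n) x) \<longlonglongrightarrow> \<psi> x - g x" for x
      unfolding TS by (intro tendsto_intros LIMSEQ_Suc lim)
    ultimately have "T \<psi> x = \<psi> x - g x" for x using LIMSEQ_unique by blast
    then have "of_real t * ?A' (?A \<psi>) x = of_real t * ?A' f x" for x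
      by (simp add: T_def g_def)
    then have eq: "?A' (?A \<psi>) = ?A' f" using t by auto
    have d: "(\<lambda>x. ?A \<psi> x - f x) \<in> l2" by (intro l2_diff(1) l2A \<psi> f)
    have "(\<lambda>x. ?A \<psi> x - f x) = (\<lambda>x. 0)"
      by (rule zero[OF d, of ?A']) (use lower'[OF d] eq in \<open>auto simp: schr_sub_diff\<close>)
    then have "?A \<psi> = f" by (metis eq_iff_diff_eq_0 ext)
    with \<psi> show ?thesis by blast
  qed
  have "bij_betw ?A l2 l2"
    unfolding bij_betw_def using inj surj l2A by (auto simp: image_iff)
  with bdd show ?thesis unfolding resolvent_set_def schr_sub_def by simp
qed

text \<open>Finitely supported functions are dense: truncation to F costs at most M times the norm
  of the tail, whose square s - sum over F tends to 0. The Floquet transform below is applied to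
  finite supports only.\<close>

lemma l2_lower_bound_from_finite:
  assumes V: "\<forall>x. \<bar>V x\<bar> \<le> C"
    and fin: "\<And>\<psi>. finite {x. \<psi> x \<noteq> 0} \<Longrightarrow> c * l2norm \<psi> \<le> l2norm (schr_sub V z \<psi>)"
    and c: "0 \<le> c" and \<psi>: "\<psi> \<in> l2"
  shows "c * l2norm \<psi> \<le> l2norm (schr_sub V z \<psi>)"
proof -
  define M where "M = 4 + C + cmod z"
  have C0: "0 \<le> C" using V[rule_format, of 0] by (rule order_trans[OF abs_ge_zero])
  have M: "0 \<le> M" unfolding M_def using C0 by simp
  define s where "s = (l2norm \<psi>)\<^sup>2"
  have sums: "(\<lambda>x. (cmod (\<psi> x))\<^sup>2) summable_on UNIV" using \<psi> by (simp add: l2_def)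
  have lim: "(sum (\<lambda>x. (cmod (\<psi> x))\<^sup>2) \<longlongrightarrow> s) (finite_subsets_at_top UNIV)"
    unfolding s_def l2norm_square by (rule infsum_tendsto[OF sums])
  have ineq: "c * sqrt (sum (\<lambda>x. (cmod (\<psi> x))\<^sup>2) F)
      \<le> l2norm (schr_sub V z \<psi>) + M * sqrt (s - sum (\<lambda>x. (cmod (\<psi> x))\<^sup>2) F)" if F: "finite F" for F
  proof -
    define u where "u x = (if x \<in> F then \<psi> x else 0)" for x
    define v where "v x = (if x \<in> F then 0 else \<psi> x)" for x
    have u: "u \<in> l2" and v: "v \<in> l2"
      by (rule l2_mult_bounded(1)[OF \<psi>, of _ 1]; simp add: u_def v_def)+
    have nu: "(l2norm u)\<^sup>2 = sum (\<lambda>x. (cmod (\<psi> x))\<^sup>2) F"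
    proof -
      have "(\<Sum>\<^sub>\<infinity>x. (cmod (u x))\<^sup>2) = (\<Sum>\<^sub>\<infinity>x\<in>F. (cmod (\<psi> x))\<^sup>2)"
        by (rule infsum_cong_neutral) (auto simp: u_def)
      then show ?thesis using F by (simp add: l2norm_square)
    qed
    have nv: "(l2norm v)\<^sup>2 = s - sum (\<lambda>x. (cmod (\<psi> x))\<^sup>2) F"
    proof -
      have "s = (\<Sum>\<^sub>\<infinity>x. (cmod (u x))\<^sup>2 + (cmod (v x))\<^sup>2)"
        unfolding s_def l2norm_square by (rule infsum_cong) (simp add: u_def v_def)
      also have "\<dots> = (l2norm u)\<^sup>2 + (l2norm v)\<^sup>2"
        unfolding l2norm_square using u v by (intro infsum_add) (auto simp: l2_def)
      finally show ?thesis using nu by simp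
    qed
    have "finite {x. u x \<noteq> 0}" by (rule finite_subset[OF _ F]) (auto simp: u_def)
    from fin[OF this] have "c * l2norm u \<le> l2norm (schr_sub V z u)" .
    also have "u = (\<lambda>x. \<psi> x - v x)" by (auto simp: u_def v_def)
    also have "l2norm (schr_sub V z (\<lambda>x. \<psi> x - v x)) \<le> l2norm (schr_sub V z \<psi>) + l2norm (schr_sub V z v)"
      unfolding schr_sub_diff by (intro l2_diff schr_sub_l2(1)[OF V] \<psi> v)
    also have "l2norm (schr_sub V z v) \<le> M * l2norm v" unfolding M_def by (rule schr_sub_l2(2)[OF V v])
    finally have "c * l2norm u \<le> l2norm (schr_sub V z \<psi>) + M * l2norm v"
      using \<open>u = (\<lambda>x. \<psi> x - v x)\<close> by simp
    moreover have "sqrt (sum (\<lambda>x. (cmod (\<psi> x))\<^sup>2) F) = l2norm u"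
      unfolding nu[symmetric] by simp
    moreover have "sqrt (s - sum (\<lambda>x. (cmod (\<psi> x))\<^sup>2) F) = l2norm v"
      unfolding nv[symmetric] by simp
    ultimately show ?thesis by simp
  qed
  have "c * sqrt s \<le> l2norm (schr_sub V z \<psi>) + M * sqrt (s - s)"
  proof (rule tendsto_le[OF _ _ _ ])
    show "((\<lambda>F. c * sqrt (sum (\<lambda>x. (cmod (\<psi> x))\<^sup>2) F)) \<longlongrightarrow> c * sqrt s) (finite_subsets_at_top UNIV)"
      by (intro tendsto_intros lim)
    show "((\<lambda>F. l2norm (schr_sub V z \<psi>) + M * sqrt (s - sum (\<lambda>x. (cmod (\<psi> x))\<^sup>2) F))
      \<longlongrightarrow> l2norm (schr_sub V z \<psi>) + M * sqrt (s - s)) (finite_subsets_at_top UNIV)"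
      by (intro tendsto_intros lim)
    show "\<forall>\<^sub>F F in finite_subsets_at_top UNIV. c * sqrt (sum (\<lambda>x. (cmod (\<psi> x))\<^sup>2) F)
      \<le> l2norm (schr_sub V z \<psi>) + M * sqrt (s - sum (\<lambda>x. (cmod (\<psi> x))\<^sup>2) F)"
      using ineq by (intro eventually_finite_subsets_at_top_weakI)
  qed simp
  then show ?thesis by (simp add: s_def)
qed

section \<open>The sign of the free characteristic product\<close>

text \<open>Multiplication by 2 cis (2x) turns the trigonometric polynomial into the value at
  \<open>cis x\<close> of a polynomial \<open>P\<close> of degree at most 4. As \<open>cos\<close>
  is injective on [0, pi], infinitely many x give infinitely many roots.\<close>

lemma trig_poly2_zero:
  fixes c0 c1 s1 c2 s2 :: real
  assumes inf: "infinite A" and sub: "A \<subseteq> {0..pi}"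
    and z: "\<And>x. x \<in> A \<Longrightarrow> c0 + c1 * cos x + s1 * sin x + c2 * cos (2 * x) + s2 * sin (2 * x) = 0"
  shows "c0 = 0 \<and> c1 = 0 \<and> s1 = 0 \<and> c2 = 0 \<and> s2 = 0"
proof -
  define P where "P = [: Complex c2 s2, Complex c1 s1, Complex (2 * c0) 0, Complex c1 (- s1), Complex c2 (- s2) :]"
  have root: "poly P (cis x) = 0" if "x \<in> A" for x
  proof -
    have 2: "cos (2 * x) = cos x * cos x - sin x * sin x" "sin (2 * x) = 2 * sin x * cos x"
      by (simp_all add: cos_double sin_double power2_eq_square)
    have c: "cis x * cis (- x) = 1" by (simp add: cis_mult)
    have "\<zeta> ^ 2 * (a * u ^ 2 + b * u + m + n * \<zeta> + k * \<zeta> ^ 2)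
      = a * (\<zeta> * u) ^ 2 + b * \<zeta> * (\<zeta> * u) + m * \<zeta> ^ 2 + n * \<zeta> ^ 3 + k * \<zeta> ^ 4"
      for \<zeta> u a b m n k :: complex
      by (simp add: algebra_simps power2_eq_square power3_eq_cube power4_eq_xxxx)
    from this[of "cis x" "Complex c2 s2" "cis (- x)"]
    have e: "cis x ^ 2 * (Complex c2 s2 * cis (- x) ^ 2 + Complex c1 s1 * cis (- x)
      + Complex (2 * c0) 0 + Complex c1 (- s1) * cis x + Complex c2 (- s2) * cis x ^ 2)
      = Complex c2 s2 + Complex c1 s1 * cis x + Complex (2 * c0) 0 * cis x ^ 2
        + Complex c1 (- s1) * cis x ^ 3 + Complex c2 (- s2) * cis x ^ 4"
      unfolding c power_one mult_1_right .
    have "poly P (cis x) = cis x ^ 2 * (Complex c2 s2 * cis (- x) ^ 2 + Complex c1 s1 * cis (- x)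
      + Complex (2 * c0) 0 + Complex c1 (- s1) * cis x + Complex c2 (- s2) * cis x ^ 2)"
      unfolding e P_def by (simp add: algebra_simps power2_eq_square power3_eq_cube power4_eq_xxxx)
    also have "Complex c2 s2 * cis (- x) ^ 2 + Complex c1 s1 * cis (- x)
      + Complex (2 * c0) 0 + Complex c1 (- s1) * cis x + Complex c2 (- s2) * cis x ^ 2 =
        of_real (2 * (c0 + c1 * cos x + s1 * sin x + c2 * cos (2 * x) + s2 * sin (2 * x)))"
      unfolding 2 by (simp add: complex_eq_iff power2_eq_square algebra_simps)
    finally show ?thesis using z[OF that] by simp
  qed
  have "inj_on cis A"
  proof (rule inj_onI)
    fix x y assume "x \<in> A" "y \<in> A" "cis x = cis y"
    then have "x \<in> {0..pi}" "y \<in> {0..pi}" "cos x = cos y" using sub by (auto simp: complex_eq_iff)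
    then show "x = y" by (auto intro: cos_inj_pi)
  qed
  then have "infinite (cis ` A)" using inf by (simp add: finite_image_iff)
  moreover have "cis ` A \<subseteq> {z. poly P z = 0}" using root by auto
  ultimately have "P = 0" using poly_roots_finite[of P] finite_subset by blast
  then show ?thesis unfolding P_def by (simp add: complex_eq_iff)
qed

text \<open>x and y are phases per lattice step, so the Bloch multipliers are
  \<open>cis (p * x)\<close> and \<open>cis (q * y)\<close>; j and l enumerate the phases with the
  same multipliers.\<close>

definition free_prod :: "nat \<Rightarrow> nat \<Rightarrow> real \<Rightarrow> real \<Rightarrow> real \<Rightarrow> real" where
  "free_prod p q E x y = (\<Prod>(j, l)\<in>{..<p} \<times> {..<q}.
     E - 2 * cos (x + 2 * pi * real j / real p) - 2 * cos (y + 2 * pi * real l / real q))"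

lemma free_prod_eq_0_iff: "free_prod p q E x y = 0 \<longleftrightarrow> (\<exists>j<p. \<exists>l<q.
     E - 2 * cos (x + 2 * pi * real j / real p) - 2 * cos (y + 2 * pi * real l / real q) = 0)"
  unfolding free_prod_def by (auto simp: prod_zero_iff)

text \<open>Already on y = 0: in x each factor has the nonzero first harmonics -2 cos and 2 sin of
  its shift, hence finitely many zeros in [0, pi], and finitely many factors cannot cover the
  interval.\<close>

lemma free_prod_nonzero: "\<exists>x y. free_prod p q E x y \<noteq> 0"
proof (rule ccontr)
  assume "\<not> ?thesis"
  then have z: "free_prod p q E x 0 = 0" for x by blast
  define B where "B = (\<lambda>(j, l). {x \<in> {0..pi}.
    E - 2 * cos (x + 2 * pi * real j / real p) - 2 * cos (0 + 2 * pi * real l / real q) = 0})"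
  have "finite (B (j, l))" for j l
  proof (rule ccontr)
    let ?d = "2 * pi * real j / real p" and ?e = "2 * pi * real l / real q"
    assume "infinite (B (j, l))"
    moreover have "B (j, l) \<subseteq> {0..pi}" by (auto simp: B_def)
    moreover have "(E - 2 * cos ?e) + (- 2 * cos ?d) * cos x + (2 * sin ?d) * sin x + 0 * cos (2 * x) + 0 * sin (2 * x) = 0"
      if "x \<in> B (j, l)" for x
      using that by (simp add: B_def cos_add algebra_simps)
    ultimately have "- 2 * cos ?d = 0 \<and> 2 * sin ?d = 0"
      using trig_poly2_zero by blast
    then show False using sin_cos_squared_add[of ?d] by simp
  qed
  then have "finite (\<Union>jl\<in>{..<p} \<times> {..<q}. B jl)" by auto
  moreover have "{0..pi} \<subseteq> (\<Union>jl\<in>{..<p} \<times> {..<q}. B jl)"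
    using z unfolding free_prod_eq_0_iff B_def by force
  moreover have "infinite {0..pi}" by (simp add: infinite_Icc)
  ultimately show False using finite_subset by blast
qed

lemma cos_2pi_frac:
  assumes "j < p" "cos (2 * pi * real j / real p) = 1"
  shows "j = 0"
proof -
  obtain n :: int where n: "2 * pi * real j / real p = of_int n * 2 * pi"
    using assms(2) by (auto simp: cos_one_2pi_int)
  then have "real j = of_int n * real p" using assms(1) by (simp add: field_simps)
  then have *: "int j = n * int p" by (metis of_int_eq_iff of_int_mult of_int_of_nat_eq)
  have "n = 0"
  proof (rule ccontr)
    assume "n \<noteq> 0"
    then have "n \<le> -1 \<or> 1 \<le> n" by linarith
    then show False
    proof
      assume "n \<le> -1" then have "n * int p < 0" using assms(1) by (simp add: mult_less_0_iff)
      then show False using * by linarith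
    next
      assume "1 \<le> n" then have "1 * int p \<le> n * int p" by (intro mult_right_mono) auto
      then show False using * assms(1) by linarith
    qed
  qed
  then show ?thesis using * by simp
qed

text \<open>Here \<open>y = arccos (E / 2 - cos x)\<close> parametrises a piece of the level curve \<open>2 cos x + 2 cos y = E\<close>.
  Squaring away \<open>sin y\<close> turns an intersection with a translate into a zero of a trigonometric polynomial of
  degree 2.\<close>

lemma finite_level_curve_translate:
  assumes "E \<noteq> 0" and ne: "cos d \<noteq> 1 \<or> cos e \<noteq> 1"
    and A: "A \<subseteq> {0..pi}" "\<And>x. x \<in> A \<Longrightarrow> \<bar>E / 2 - cos x\<bar> \<le> 1"
  shows "finite {x \<in> A. E - 2 * cos (x + d) - 2 * cos (arccos (E / 2 - cos x) + e) = 0}" (is "finite ?B")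
proof (rule ccontr)
  assume inf: "infinite ?B"
  \<comment> \<open>On the curve, the translate imposes \<sigma> sin y = -(\<kappa> cos x + \<beta>
    sin x + \<gamma> E / 2). The square of this, with the square of sin y eliminated, has the five
    coefficients displayed next.\<close>
  define \<beta> where "\<beta> = sin d"
  define \<gamma> where "\<gamma> = 1 - cos e"
  define \<sigma> where "\<sigma> = sin e"
  define \<kappa> where "\<kappa> = 1 - cos d - \<gamma>"
  have "(\<sigma>\<^sup>2 * (1/2 - E\<^sup>2/4) - \<kappa>\<^sup>2/2 - \<beta>\<^sup>2/2 - \<gamma>\<^sup>2*E\<^sup>2/4) + (\<sigma>\<^sup>2 * E - \<kappa> * \<gamma> * E) * cos x + (- \<beta> * \<gamma> * E) * sin x
    + (- \<sigma>\<^sup>2/2 - \<kappa>\<^sup>2/2 + \<beta>\<^sup>2/2) * cos (2 * x) + (- \<kappa> * \<beta>) * sin (2 * x) = 0" if x: "x \<in> ?B" for x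
  proof -
    define y where "y = arccos (E / 2 - cos x)"
    have cy: "cos y = E / 2 - cos x" unfolding y_def using A(2) x by (intro cos_arccos_abs) auto
    have s2: "(sin y)\<^sup>2 = 1 - (E / 2 - cos x)\<^sup>2" using sin_cos_squared_add[of y] unfolding cy by simp
    have "E - 2 * cos (x + d) - 2 * cos (y + e) = 0" using x by (simp add: y_def)
    then have "E - 2 * (cos x * cos d - sin x * sin d) - 2 * ((E / 2 - cos x) * cos e - sin y * sin e) = 0"
      unfolding cos_add cy .
    then have "\<sigma> * sin y = - (\<kappa> * cos x + \<beta> * sin x + \<gamma> * E / 2)"
      unfolding \<sigma>_def \<kappa>_def \<beta>_def \<gamma>_def by argo
    then have "(\<sigma> * sin y)\<^sup>2 = (\<kappa> * cos x + \<beta> * sin x + \<gamma> * E / 2)\<^sup>2" by (metis power2_minus)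
    then have eq: "\<sigma>\<^sup>2 * (1 - (E / 2 - cos x)\<^sup>2) = (\<kappa> * cos x + \<beta> * sin x + \<gamma> * E / 2)\<^sup>2"
      by (simp add: power_mult_distrib s2)
    have d2: "cos (2 * x) = 2 * (cos x)\<^sup>2 - 1" "sin (2 * x) = 2 * sin x * cos x"
      by (simp_all add: cos_double_cos sin_double)
    have sx: "(sin x)\<^sup>2 = 1 - (cos x)\<^sup>2" by (simp add: sin_squared_eq)
    have "(\<kappa> * cos x + \<beta> * sin x + \<gamma> * E / 2)\<^sup>2 = \<kappa>\<^sup>2 * (cos x)\<^sup>2 + \<beta>\<^sup>2 * (1 - (cos x)\<^sup>2) + \<gamma>\<^sup>2 * E\<^sup>2 / 4
       + 2 * \<kappa> * \<beta> * cos x * sin x + \<kappa> * \<gamma> * E * cos x + \<beta> * \<gamma> * E * sin x"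
      unfolding sx[symmetric] by (simp add: power2_eq_square algebra_simps add_divide_distrib)
    then show ?thesis using eq unfolding d2 by (simp add: power2_eq_square algebra_simps add_divide_distrib diff_divide_distrib)
  qed
  from trig_poly2_zero[OF inf _ this] have "(\<sigma>\<^sup>2 * (1/2 - E\<^sup>2/4) - \<kappa>\<^sup>2/2 - \<beta>\<^sup>2/2 - \<gamma>\<^sup>2*E\<^sup>2/4) = 0"
    "\<sigma>\<^sup>2 * E - \<kappa> * \<gamma> * E = 0" "- \<beta> * \<gamma> * E = 0" "- \<sigma>\<^sup>2/2 - \<kappa>\<^sup>2/2 + \<beta>\<^sup>2/2 = 0" "- \<kappa> * \<beta> = 0"
    using A(1) by auto
  note e = this
  \<comment> \<open>Here and for \<gamma> a factor E is cancelled. At E = 0 the translate by (pi,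
    pi) is the level curve itself, so no such argument could work.\<close>
  have b: "\<beta> = 0"
  proof (rule ccontr)
    assume "\<beta> \<noteq> 0"
    then have "\<gamma> = 0" "\<kappa> = 0" using e(3,5) \<open>E \<noteq> 0\<close> by auto
    then have "\<sigma> = 0" using e(2) \<open>E \<noteq> 0\<close> by simp
    then show False using e(4) \<open>\<kappa> = 0\<close> \<open>\<beta> \<noteq> 0\<close> by simp
  qed
  have "- \<sigma>\<^sup>2/2 - \<kappa>\<^sup>2/2 = 0" using e(4) unfolding b by simp
  then have "\<sigma>\<^sup>2 + \<kappa>\<^sup>2 = 0" by linarith
  then have sk: "\<sigma> = 0" "\<kappa> = 0" unfolding sum_power2_eq_zero_iff by blast+
  have "\<gamma> = 0" using sk e(1) b \<open>E \<noteq> 0\<close> by simp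
  then show False using sk ne unfolding \<kappa>_def \<gamma>_def by auto
qed

text \<open>Infinitely many points of the level curve are available and only finitely many meet a
  translate. At a remaining point the other factors have a nonzero product \<open>r\<close>, while
  the factor (0, 0) equals 2 (cos y - cos y') and changes sign as y' crosses y.\<close>

lemma free_prod_sign_change_nonzero:
  assumes pq: "0 < p" "0 < q" and E: "-4 < E" "E < 4" "E \<noteq> 0"
  shows "\<exists>x y y'. free_prod p q E x y < 0 \<and> 0 < free_prod p q E x y'"
proof -
  \<comment> \<open>The values t = cos x for which t and E/2 - t both lie in (-1, 1); the interval
    is nonempty exactly because E lies between -4 and 4.\<close>
  define I where "I = {max (-1) (E/2 - 1)<..<min 1 (E/2 + 1)}"
  have I: "infinite I" unfolding I_def using E by (intro infinite_Ioo) auto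
  have Iin: "-1 < t \<and> t < 1 \<and> -1 < E/2 - t \<and> E/2 - t < 1" if "t \<in> I" for t
    using that unfolding I_def by auto
  define A where "A = arccos ` I"
  have Ac: "cos x \<in> I" if "x \<in> A" for x
  proof -
    have "x \<in> arccos ` I" using that by (simp add: A_def)
    then obtain t where t: "t \<in> I" "x = arccos t" by blast
    then show ?thesis using Iin[OF t(1)] by (simp add: cos_arccos)
  qed
  have "inj_on arccos I" using Iin by (intro inj_onI) (metis cos_arccos less_imp_le)
  then have A: "infinite A" using I by (simp add: A_def finite_image_iff)
  have Api: "A \<subseteq> {0..pi}"
  proof
    fix x assume "x \<in> A"
    then obtain t where t: "t \<in> I" "x = arccos t" unfolding A_def by blast
    then show "x \<in> {0..pi}" using Iin[OF t(1)] arccos_bounded[of t] by simp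
  qed
  define y0 where "y0 x = arccos (E/2 - cos x)" for x
  define K where "K = {..<p} \<times> {..<q}"
  define F where "F x y = (\<lambda>(j, l). E - 2 * cos (x + 2 * pi * real j / real p) - 2 * cos (y + 2 * pi * real l / real q))" for x y
  have K: "finite K" "(0,0) \<in> K" using pq by (auto simp: K_def)
  have "finite {x \<in> A. F x (y0 x) jl = 0}" if jl: "jl \<in> K - {(0,0)}" for jl
  proof -
    obtain j l where [simp]: "jl = (j, l)" by (cases jl)
    have ne: "cos (2 * pi * real j / real p) \<noteq> 1 \<or> cos (2 * pi * real l / real q) \<noteq> 1"
      using cos_2pi_frac[of j p] cos_2pi_frac[of l q] jl by (auto simp: K_def)
    have "\<bar>E / 2 - cos x\<bar> \<le> 1" if "x \<in> A" for x using Iin[OF Ac[OF that]] by linarith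
    from finite_level_curve_translate[OF E(3) ne Api this]
    show ?thesis unfolding F_def y0_def by simp
  qed
  then have "finite (\<Union>jl\<in>K - {(0,0)}. {x \<in> A. F x (y0 x) jl = 0})" using K by auto
  then obtain x where x: "x \<in> A" "x \<notin> (\<Union>jl\<in>K - {(0,0)}. {x \<in> A. F x (y0 x) jl = 0})"
    using A by (meson finite_subset subsetI)
  define y where "y = y0 x"
  define r where "r y = prod (F x y) (K - {(0,0)})" for y
  have r0: "r y \<noteq> 0" unfolding r_def using x K by (auto simp: y_def)
  have cy: "cos y = E/2 - cos x" unfolding y_def y0_def using Iin[OF Ac[OF x(1)]] by (intro cos_arccos) auto
  have ypi: "0 < y" "y < pi" unfolding y_def y0_def using arccos_lt_bounded Iin[OF Ac[OF x(1)]] by auto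
  have fp: "free_prod p q E x y' = 2 * (cos y - cos y') * r y'" for y'
  proof -
    have "free_prod p q E x y' = prod (F x y') K" unfolding free_prod_def F_def K_def ..
    also have "\<dots> = F x y' (0,0) * r y'" unfolding r_def using K by (subst prod.remove[of _ "(0,0)"]) auto
    also have "F x y' (0,0) = 2 * (cos y - cos y')" unfolding F_def cy by simp
    finally show ?thesis .
  qed
  have "isCont r y" unfolding r_def F_def case_prod_unfold by (intro continuous_intros)
  then obtain d where d: "0 < d" "\<And>y'. dist y' y < d \<Longrightarrow> dist (r y') (r y) < \<bar>r y\<bar>"
    using r0 unfolding continuous_at_eps_delta by (metis zero_less_abs_iff)
  \<comment> \<open>The bounds keep y - h and y + h where \<open>r\<close> retains its sign and
    inside (0, pi), where \<open>cos\<close> decreases strictly.\<close>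
  define h where "h = min (d / 2) (min (y / 2) ((pi - y) / 2))"
  have "h \<le> (pi - y) / 2" unfolding h_def by (meson min.cobounded2 order_trans)
  then have h: "0 < h" "h < d" "h < y" "y + h < pi" using d(1) ypi by (simp_all add: h_def)
  have c1: "cos y < cos (y - h)" using h ypi by (intro cos_monotone_0_pi) auto
  have c2: "cos (y + h) < cos y" using h ypi by (intro cos_monotone_0_pi) auto
  have r1: "\<bar>r (y - h) - r y\<bar> < \<bar>r y\<bar>" "\<bar>r (y + h) - r y\<bar> < \<bar>r y\<bar>"
    using d(2)[of "y - h"] d(2)[of "y + h"] h(1,2) by (auto simp: dist_real_def)
  show ?thesis
  proof (cases "0 < r y")
    case True
    then have "0 < r (y - h)" "0 < r (y + h)" using r1 by linarith+
    then have "free_prod p q E x (y - h) < 0" "0 < free_prod p q E x (y + h)"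
      unfolding fp using c1 c2 by (simp_all add: mult_less_0_iff)
    then show ?thesis by blast
  next
    case False
    then have "r (y - h) < 0" "r (y + h) < 0" using r1 by linarith+
    then have "0 < free_prod p q E x (y - h)" "free_prod p q E x (y + h) < 0"
      unfolding fp using c1 c2 by (simp_all add: mult_less_0_iff zero_less_mult_iff)
    then show ?thesis by blast
  qed
qed

lemma free_prod_swap: "free_prod p q E x y = free_prod q p E y x"
  unfolding free_prod_def
  by (rule prod.reindex_bij_witness[of _ prod.swap prod.swap]) auto

text \<open>At \<open>E = 0\<close> the factors split by the sum-to-product formula, and a simultaneous shift of both
  arguments by \<open>\<pi> / q\<close> permutes the zeros of one of the two resulting products cyclically.\<close>

lemma free_prod_zero_shift:
  assumes "0 < q"
  shows "free_prod p q 0 (x + pi / q) (y + pi / q) = (-1) ^ p * free_prod p q 0 x y"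
proof -
  obtain m where q: "q = Suc m" using assms gr0_implies_Suc by blast
  define h where "h j l = cos ((x + y) / 2 + pi * real j / real p + pi * real l / real q)" for j l
  define k where "k j l = -4 * cos ((x - y) / 2 + pi * real j / real p - pi * real l / real q)" for j l
  \<comment> \<open>A common shift s moves the half-sum of the two arguments by s and leaves their
    half-difference fixed.\<close>
  have fac: "0 - 2 * cos (x + s + 2 * pi * real j / real p) - 2 * cos (y + s + 2 * pi * real l / real q)
     = cos ((x + y) / 2 + pi * real j / real p + pi * real l / real q + s) * k j l" for j l s
  proof -
    let ?u = "x + s + 2 * pi * real j / real p" and ?v = "y + s + 2 * pi * real l / real q"
    have a: "(?u + ?v) / 2 = (x + y) / 2 + pi * real j / real p + pi * real l / real q + s"
      and b: "(?u - ?v) / 2 = (x - y) / 2 + pi * real j / real p - pi * real l / real q"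
      by (simp_all add: add_divide_distrib diff_divide_distrib)
    show ?thesis using cos_plus_cos[of ?u ?v] unfolding a b k_def by linarith
  qed
  have "free_prod p q 0 (x + pi / q) (y + pi / q) = (\<Prod>j<p. \<Prod>l<q. h j (Suc l) * k j l)"
    unfolding free_prod_def fac prod.cartesian_product[symmetric] h_def
    by (intro prod.cong refl arg_cong2[of _ _ _ _ "(*)"] arg_cong[of _ _ cos])
      (simp add: add_divide_distrib ring_distribs)
  also have "\<dots> = (\<Prod>j<p. (\<Prod>l<q. h j (Suc l)) * (\<Prod>l<q. k j l))"
    by (simp only: prod.distrib)
  also have "\<dots> = (\<Prod>j<p. - ((\<Prod>l<q. h j l) * (\<Prod>l<q. k j l)))"
  proof (intro prod.cong refl)
    fix j
    \<comment> \<open>One full cycle in l advances the half-sum only by pi, so the wrap-around costs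
      one sign for each j.\<close>
    have "h j q = - h j 0" unfolding h_def using assms by (simp add: cos_add)
    then have "(\<Prod>l<q. h j (Suc l)) = - (\<Prod>l<q. h j l)"
      unfolding q by (subst (2) prod.lessThan_Suc_shift) simp
    then show "(\<Prod>l<q. h j (Suc l)) * (\<Prod>l<q. k j l) = - ((\<Prod>l<q. h j l) * (\<Prod>l<q. k j l))" by simp
  qed
  also have "\<dots> = (-1) ^ p * (\<Prod>j<p. (\<Prod>l<q. h j l) * (\<Prod>l<q. k j l))"
    by (simp add: prod_uminus)
  also have "(\<Prod>j<p. (\<Prod>l<q. h j l) * (\<Prod>l<q. k j l)) = (\<Prod>j<p. \<Prod>l<q. h j l * k j l)"
    by (simp only: prod.distrib)
  also have "\<dots> = free_prod p q 0 x y"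
    unfolding free_prod_def prod.cartesian_product[symmetric] h_def
    using fac[where s = 0] by (intro prod.cong refl) simp
  finally show ?thesis .
qed

text \<open>The shift by pi/q multiplies by (-1)^p, so odd p flips the sign of a nonzero value; odd
  q is handled by exchanging the coordinates.\<close>

lemma free_prod_sign_change_zero:
  assumes pq: "0 < p" "0 < q" and "odd p \<or> odd q"
  shows "\<exists>x y x' y'. free_prod p q 0 x y < 0 \<and> 0 < free_prod p q 0 x' y'"
proof -
  obtain x y where xy: "free_prod p q 0 x y \<noteq> 0" using free_prod_nonzero by blast
  have "\<exists>x' y'. free_prod p q 0 x' y' = - free_prod p q 0 x y"
  proof (cases "odd p")
    case True
    then show ?thesis using free_prod_zero_shift[OF pq(2), of p x y] by auto
  next
    case False
    then have "odd q" using assms by simp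
    then show ?thesis using free_prod_zero_shift[OF pq(1), of q y x]
      unfolding free_prod_swap[of q p] by auto
  qed
  with xy show ?thesis by (metis less_linear neg_0_less_iff_less neg_less_0_iff_less)
qed

section \<open>Bloch functions and Floquet matrices\<close>

lemma mult_add_less_mult:
  fixes j l :: nat
  assumes "j < p" "l < q"
  shows "j * q + l < p * q"
proof -
  have "j * q + l < Suc j * q" using assms(2) by simp
  also have "\<dots> \<le> p * q" using assms(1) by (intro mult_right_mono) auto
  finally show ?thesis .
qed

lemma bij_betw_div_mod:
  "0 < q \<Longrightarrow> bij_betw (\<lambda>i::nat. (i div q, i mod q)) {..<p * q} ({..<p} \<times> {..<q})"
  by (rule bij_betw_byWitness[where f' = "\<lambda>(j, l). j * q + l"])
    (auto simp: less_mult_imp_div_less mult.commute intro!: mult_add_less_mult)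

text \<open>The bound on s makes the root equal to 1 only for s = 0. This is the orthogonality
  behind both the Fourier matrix of the free problem and the Parseval identity.\<close>

lemma sum_roots_of_unity:
  assumes "0 < L" "\<bar>s\<bar> < int L"
  shows "(\<Sum>i<L. cis (2 * pi * of_int s / real L) ^ i) = (if s = 0 then of_nat L else 0)"
proof (cases "s = 0")
  case False
  define w where "w = cis (2 * pi * of_int s / real L)"
  have "w \<noteq> 1"
  proof
    assume "w = 1"
    then have "cos (2 * pi * of_int s / real L) = 1" by (simp add: w_def complex_eq_iff)
    moreover have "cos (2 * pi * of_int s / real L) = cos (2 * pi * real (nat \<bar>s\<bar>) / real L)"
    proof (cases "0 \<le> s")
      case False
      then have "2 * pi * real (nat \<bar>s\<bar>) / real L = - (2 * pi * of_int s / real L)" by simp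
      then show ?thesis by (simp only: cos_minus)
    qed simp
    ultimately have "nat \<bar>s\<bar> = 0" using assms by (intro cos_2pi_frac[of "nat \<bar>s\<bar>" L]) auto
    then show False using False by simp
  qed
  moreover have "w ^ L = 1"
  proof -
    have "real L * (2 * pi * of_int s / real L) = 2 * pi * of_int s" using assms(1) by simp
    then have "w ^ L = cis (2 * pi * of_int s)" unfolding w_def Complex.DeMoivre by (simp only:)
    also have "\<dots> = 1" by (rule cis_multiple_2pi) simp
    finally show ?thesis .
  qed
  ultimately have "(\<Sum>i<L. w ^ i) = 0" by (simp add: geometric_sum)
  then show ?thesis using False by (simp add: w_def)
qed simp

locale period =
  fixes p q :: nat
  assumes p_pos: "0 < p" and q_pos: "0 < q"
begin

definition cell :: "nat \<Rightarrow> int \<times> int" where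
  "cell k = (int (k div q), int (k mod q))"

definition idx :: "int \<times> int \<Rightarrow> nat" where
  "idx x = nat (fst x mod int p) * q + nat (snd x mod int q)"

definition bloch :: "complex \<Rightarrow> complex \<Rightarrow> (int \<times> int \<Rightarrow> complex) \<Rightarrow> bool" where
  "bloch a b \<psi> \<longleftrightarrow> (\<forall>n m s t. \<psi> (n + s * int p, m + t * int q) = a powi s * b powi t * \<psi> (n, m))"

text \<open>Quasi-periodic extension of values on the fundamental cell, which \<open>cell\<close>
  and \<open>idx\<close> number row by row.\<close>

definition bext :: "complex \<Rightarrow> complex \<Rightarrow> (nat \<Rightarrow> complex) \<Rightarrow> int \<times> int \<Rightarrow> complex" where
  "bext a b u x = a powi (fst x div int p) * b powi (snd x div int q) * u (idx x)"

lemma idx_less: "idx x < p * q"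
  unfolding idx_def using p_pos q_pos
  by (intro mult_add_less_mult) (auto simp: nat_less_iff)

lemma cell_idx: "cell (idx x) = (fst x mod int p, snd x mod int q)"
proof -
  have "nat (snd x mod int q) < q" using q_pos by (simp add: nat_less_iff)
  then show ?thesis using p_pos q_pos by (simp add: cell_def idx_def)
qed

lemma idx_cell: "k < p * q \<Longrightarrow> idx (cell k) = k"
  using q_pos by (simp add: cell_def idx_def less_mult_imp_div_less flip: of_nat_mod)

lemma cell_div: "k < p * q \<Longrightarrow> fst (cell k) div int p = 0 \<and> snd (cell k) div int q = 0"
  using q_pos by (simp add: cell_def less_mult_imp_div_less)

lemma bext_cell: "k < p * q \<Longrightarrow> bext a b u (cell k) = u k"
  using cell_div[of k] by (simp add: bext_def idx_cell)

lemma bloch_bext: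
  assumes "a \<noteq> 0" "b \<noteq> 0"
  shows "bloch a b (bext a b u)"
  unfolding bloch_def bext_def idx_def using p_pos q_pos assms
  by (simp add: power_int_add mult_ac)

lemma bloch_eq:
  assumes "bloch a b \<psi>"
  shows "\<psi> = bext a b (\<lambda>k. \<psi> (cell k))"
proof
  fix x :: "int \<times> int"
  have "x = (fst x mod int p + (fst x div int p) * int p, snd x mod int q + (snd x div int q) * int q)"
    by simp
  then have "\<psi> x = a powi (fst x div int p) * b powi (snd x div int q) * \<psi> (fst x mod int p, snd x mod int q)"
    using assms unfolding bloch_def by metis
  then show "\<psi> x = bext a b (\<lambda>k. \<psi> (cell k)) x" by (simp add: bext_def cell_idx)
qed

lemma periodic_multiple:
  assumes "periodic_pq (int p) (int q) V"
  shows "V (n + s * int p, m + t * int q) = V (n, m)"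
proof -
  have step: "V (n + s * int p, m) = V (n, m) \<and> V (n, m + s * int q) = V (n, m)" for n m s
  proof (induction s rule: int_induct[where k = 0])
    case base then show ?case by simp
  next
    case (step1 i)
    have "V ((n + i * int p) + int p, m) = V (n + i * int p, m)"
      "V (n, (m + i * int q) + int q) = V (n, m + i * int q)"
      using assms by (auto simp: periodic_pq_def)
    then show ?case using step1 by (simp add: algebra_simps)
  next
    case (step2 i)
    have "V ((n + (i - 1) * int p) + int p, m) = V (n + (i - 1) * int p, m)"
      "V (n, (m + (i - 1) * int q) + int q) = V (n, m + (i - 1) * int q)"
      using assms by (auto simp: periodic_pq_def)
    then show ?case using step2 by (simp add: algebra_simps)
  qed
  then show ?thesis by metis
qed

lemma bloch_schr_op:
  assumes "periodic_pq (int p) (int q) V" "bloch a b \<psi>"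
  shows "bloch a b (schr_op V \<psi>)"
proof -
  have \<psi>: "\<psi> (n + s * int p, m + t * int q) = a powi s * b powi t * \<psi> (n, m)" for n m s t
    using assms(2) by (auto simp: bloch_def)
  show ?thesis unfolding bloch_def
  proof (intro allI)
    fix n m s t
    have "\<psi> (n + s * int p - 1, m + t * int q) = a powi s * b powi t * \<psi> (n - 1, m)"
      "\<psi> (n + s * int p + 1, m + t * int q) = a powi s * b powi t * \<psi> (n + 1, m)"
      "\<psi> (n + s * int p, m + t * int q - 1) = a powi s * b powi t * \<psi> (n, m - 1)"
      "\<psi> (n + s * int p, m + t * int q + 1) = a powi s * b powi t * \<psi> (n, m + 1)"
      using \<psi>[of "n - 1" s m t] \<psi>[of "n + 1" s m t] \<psi>[of n s "m - 1" t] \<psi>[of n s "m + 1" t]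
      by (simp_all add: algebra_simps)
    then show "schr_op V \<psi> (n + s * int p, m + t * int q) = a powi s * b powi t * schr_op V \<psi> (n, m)"
      by (simp add: schr_op_def \<psi> periodic_multiple[OF assms(1)] algebra_simps)
  qed
qed

text \<open>Column k is H applied to the Bloch extension of the k-th unit vector. Wrap-around terms
  thereby carry the right multipliers, even for periods 1 and 2, where neighbours share an
  index.\<close>

definition bmat :: "(int \<times> int \<Rightarrow> real) \<Rightarrow> complex \<Rightarrow> complex \<Rightarrow> complex mat" where
  "bmat V a b = mat (p * q) (p * q) (\<lambda>(i, k). schr_op V (bext a b (\<lambda>j. if j = k then 1 else 0)) (cell i))"

definition bshift :: "(int \<times> int \<Rightarrow> real) \<Rightarrow> complex \<Rightarrow> complex \<Rightarrow> complex \<Rightarrow> complex mat" where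
  "bshift V a b z = mat (p * q) (p * q) (\<lambda>(i, k). (if i = k then z else 0) - bmat V a b $$ (i, k))"

definition bdet :: "(int \<times> int \<Rightarrow> real) \<Rightarrow> complex \<Rightarrow> complex \<Rightarrow> complex \<Rightarrow> complex" where
  "bdet V a b z = det (bshift V a b z)"

lemma bmat_carrier [simp]: "bmat V a b \<in> carrier_mat (p * q) (p * q)"
  and bshift_carrier [simp]: "bshift V a b z \<in> carrier_mat (p * q) (p * q)"
  by (auto simp: bmat_def bshift_def)

lemma schr_op_sum:
  "schr_op V (\<lambda>x. \<Sum>k\<in>K. c k * f k x) x = (\<Sum>k\<in>K. c k * schr_op V (f k) x)"
  by (simp add: schr_op_shift sum.distrib sum_distrib_left algebra_simps)

lemma bext_expand: "bext a b u x = (\<Sum>k<p * q. u k * bext a b (\<lambda>j. if j = k then 1 else 0) x)"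
proof -
  have "(\<Sum>k<p * q. u k * bext a b (\<lambda>j. if j = k then 1 else 0) x)
    = (\<Sum>k<p * q. if idx x = k then a powi (fst x div int p) * b powi (snd x div int q) * u k else 0)"
    by (intro sum.cong) (auto simp: bext_def)
  then show ?thesis using idx_less[of x] by (simp add: bext_def)
qed

lemma bshift_mult_bloch:
  assumes "bloch a b \<psi>"
  shows "bshift V a b z *\<^sub>v vec (p * q) (\<lambda>k. \<psi> (cell k))
    = vec (p * q) (\<lambda>k. z * \<psi> (cell k) - schr_op V \<psi> (cell k))"
proof (rule eq_vecI)
  fix i assume i: "i < dim_vec (vec (p * q) (\<lambda>k. z * \<psi> (cell k) - schr_op V \<psi> (cell k)))"
  then have i: "i < p * q" by simp
  let ?e = "\<lambda>k. bext a b (\<lambda>j. if j = k then 1 else 0)"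
  have "schr_op V \<psi> (cell i) = schr_op V (\<lambda>x. \<Sum>k<p * q. \<psi> (cell k) * ?e k x) (cell i)"
    by (subst bloch_eq[OF assms], subst bext_expand[abs_def]) simp
  also have "\<dots> = (\<Sum>k<p * q. \<psi> (cell k) * schr_op V (?e k) (cell i))" by (rule schr_op_sum)
  finally have s: "schr_op V \<psi> (cell i) = (\<Sum>k<p * q. \<psi> (cell k) * schr_op V (?e k) (cell i))" .
  have "(bshift V a b z *\<^sub>v vec (p * q) (\<lambda>k. \<psi> (cell k))) $ i
    = (\<Sum>k<p * q. ((if i = k then z else 0) - schr_op V (?e k) (cell i)) * \<psi> (cell k))"
    using i by (simp add: bshift_def bmat_def scalar_prod_def lessThan_atLeast0)
  also have "\<dots> = (\<Sum>k<p * q. (if i = k then z * \<psi> (cell k) else 0)) - (\<Sum>k<p * q. \<psi> (cell k) * schr_op V (?e k) (cell i))"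
    by (subst sum_subtractf[symmetric], rule sum.cong) (auto simp: algebra_simps)
  also have "\<dots> = z * \<psi> (cell i) - schr_op V \<psi> (cell i)" using i s by simp
  finally show "(bshift V a b z *\<^sub>v vec (p * q) (\<lambda>k. \<psi> (cell k))) $ i
    = vec (p * q) (\<lambda>k. z * \<psi> (cell k) - schr_op V \<psi> (cell k)) $ i" using i by simp
qed (simp add: bshift_def)

lemma bdet_eq_0_imp_bloch:
  assumes V: "periodic_pq (int p) (int q) V" and ab: "a \<noteq> 0" "b \<noteq> 0" and z: "bdet V a b z = 0"
  obtains \<psi> x0 where "bloch a b \<psi>" "\<psi> x0 \<noteq> 0" "\<And>x. schr_op V \<psi> x = z * \<psi> x"
proof -
  obtain v where v: "v \<in> carrier_vec (p * q)" "v \<noteq> 0\<^sub>v (p * q)" "bshift V a b z *\<^sub>v v = 0\<^sub>v (p * q)"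
    using z unfolding bdet_def det_0_iff_vec_prod_zero[OF bshift_carrier] by blast
  define \<psi> where "\<psi> = bext a b (\<lambda>k. v $ k)"
  have b: "bloch a b \<psi>" unfolding \<psi>_def by (rule bloch_bext[OF ab])
  have vv: "vec (p * q) (\<lambda>k. \<psi> (cell k)) = v" using v(1) by (intro eq_vecI) (auto simp: \<psi>_def bext_cell)
  have "z * \<psi> (cell k) - schr_op V \<psi> (cell k) = 0" if "k < p * q" for k
    using arg_cong[OF bshift_mult_bloch[OF b, of V z], of "\<lambda>v. v $ k"] that unfolding vv v(3) by simp
  then have cells: "schr_op V \<psi> (cell k) = z * \<psi> (cell k)" if "k < p * q" for k using that by simp
  have "schr_op V \<psi> x = z * \<psi> x" for x
    by (subst bloch_eq[OF bloch_schr_op[OF V b]], subst bloch_eq[OF b])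
      (simp add: bext_def cells idx_less)
  moreover obtain k where "k < p * q" "v $ k \<noteq> 0"
    using v(1,2) by (metis carrier_vecD eq_vecI index_zero_vec)
  then have "\<psi> (cell k) \<noteq> 0" by (simp add: \<psi>_def bext_cell)
  ultimately show thesis using that[OF b] by blast
qed

lemma bloch_bounded:
  assumes "bloch a b \<psi>" "cmod a = 1" "cmod b = 1"
  shows "cmod (\<psi> x) \<le> (\<Sum>k<p * q. cmod (\<psi> (cell k)))"
proof -
  have "cmod (\<psi> x) = cmod (\<psi> (cell (idx x)))"
    by (subst bloch_eq[OF assms(1)]) (simp add: bext_def norm_mult norm_power_int assms)
  also have "\<dots> \<le> (\<Sum>k<p * q. cmod (\<psi> (cell k)))"
    by (rule member_le_sum) (auto simp: idx_less)
  finally show ?thesis .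
qed

text \<open>A kernel vector extends to a Bloch eigenfunction, bounded because the multipliers have
  modulus 1; the damping results then apply.\<close>

lemma bdet_eq_0_spectrum:
  assumes V: "periodic_pq (int p) (int q) V" "\<forall>x. \<bar>V x\<bar> \<le> C"
    and ab: "cmod a = 1" "cmod b = 1" and z: "bdet V a b z = 0"
  shows "z \<in> spectrum_H V" "Im z = 0" "cmod z \<le> 4 + C"
proof -
  have ab0: "a \<noteq> 0" "b \<noteq> 0" using ab by auto
  obtain \<psi> x0 where \<psi>: "bloch a b \<psi>" "\<psi> x0 \<noteq> 0" "\<And>x. schr_op V \<psi> x = z * \<psi> x"
    using bdet_eq_0_imp_bloch[OF V(1) ab0 z] by blast
  note bd = bloch_bounded[OF \<psi>(1) ab]
  show "z \<in> spectrum_H V" by (rule bounded_eigenfunction_spectrum[OF bd \<psi>(2,3)])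
  show "Im z = 0" by (rule bounded_eigenfunction_real[OF V(2) bd \<psi>(2,3)])
  show "cmod z \<le> 4 + C" by (rule bounded_eigenfunction_bound[OF V(2) bd \<psi>(2,3)])
qed

lemma bdet_factorized:
  obtains as where "length as = p * q" "\<And>z. bdet V a b z = (\<Prod>c\<leftarrow>as. z - c)"
proof -
  obtain as where as: "char_poly (bmat V a b) = (\<Prod>c\<leftarrow>as. [:- c, 1:])" "length as = p * q"
    using char_poly_factorized[OF bmat_carrier] by blast
  have "bdet V a b z = (\<Prod>c\<leftarrow>as. z - c)" for z
  proof -
    have "bdet V a b z = det (- char_matrix (bmat V a b) z)"
      unfolding bdet_def by (rule arg_cong[of _ _ det], rule eq_matI) (auto simp: bshift_def char_matrix_def bmat_def)
    also have "\<dots> = poly (char_poly (bmat V a b)) z" by (rule char_poly_matrix[OF bmat_carrier, symmetric])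
    also have "\<dots> = (\<Prod>c\<leftarrow>as. z - c)" unfolding as(1) by (induction as) (auto simp: left_diff_distrib)
    finally show ?thesis .
  qed
  with as(2) show thesis using that by blast
qed

end

section \<open>The free Floquet determinant\<close>

definition plane_wave :: "real \<Rightarrow> real \<Rightarrow> int \<times> int \<Rightarrow> complex" where
  "plane_wave u v x = cis (u * of_int (fst x) + v * of_int (snd x))"

lemma schr_op_plane_wave:
  "schr_op (\<lambda>_. 0) (plane_wave u v) x = of_real (2 * cos u + 2 * cos v) * plane_wave u v x"
proof -
  have s: "plane_wave u v (x + d) = cis (u * of_int (fst d) + v * of_int (snd d)) * plane_wave u v x" for d
    unfolding plane_wave_def cis_mult by (simp add: algebra_simps)
  have t: "of_real (2 * cos t) = cis (- t) + cis t" for t by (simp add: complex_eq_iff)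
  show ?thesis unfolding schr_op_shift s of_real_add t by (simp add: distrib_right)
qed

context period
begin

lemma bloch_plane_wave:
  "bloch (cis (real p * x)) (cis (real q * y))
     (plane_wave (x + 2 * pi * real j / real p) (y + 2 * pi * real l / real q))"
  unfolding bloch_def
proof (intro allI)
  fix n m s t :: int
  let ?u = "x + 2 * pi * real j / real p" and ?v = "y + 2 * pi * real l / real q"
  have "?u * of_int (n + s * int p) + ?v * of_int (m + t * int q)
    = (of_int s * (real p * x) + of_int t * (real q * y) + (?u * of_int n + ?v * of_int m)) + 2 * pi * of_int (int j * s + int l * t)"
    using p_pos q_pos by (simp add: field_simps)
  then show "plane_wave ?u ?v (n + s * int p, m + t * int q)
    = cis (real p * x) powi s * cis (real q * y) powi t * plane_wave ?u ?v (n, m)"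
    unfolding plane_wave_def fst_conv snd_conv cis_power_int cis_mult
    by (simp only: cis_mult[symmetric] cis_multiple_2pi Ints_of_int mult_1_right)
qed

text \<open>The pq plane waves compatible with the multipliers diagonalise the free matrix: B F = F
  D with F their values on the cell. F is invertible, so its determinant cancels and the diagonal of
  D remains.\<close>

lemma bdet_free:
  "bdet (\<lambda>_. 0) (cis (real p * x)) (cis (real q * y)) (of_real E) = of_real (free_prod p q E x y)"
proof -
  let ?N = "p * q"
  define u where "u k = x + 2 * pi * real (k div q) / real p" for k
  define v where "v k = y + 2 * pi * real (k mod q) / real q" for k
  define e where "e k = E - 2 * cos (u k) - 2 * cos (v k)" for k
  define w where "w k = plane_wave (u k) (v k)" for k
  define F where "F = mat ?N ?N (\<lambda>(i, k). w k (cell i))"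
  define G where "G = mat ?N ?N (\<lambda>(k, i). cnj (w k (cell i)))"
  define D where "D = mat ?N ?N (\<lambda>(i, k). if i = k then complex_of_real (e k) else 0)"
  let ?B = "bshift (\<lambda>_. 0) (cis (real p * x)) (cis (real q * y)) (of_real E)"
  have car: "F \<in> carrier_mat ?N ?N" "G \<in> carrier_mat ?N ?N" "D \<in> carrier_mat ?N ?N"
    by (auto simp: F_def G_def D_def)
  have "?B * F = F * D"
  proof (rule eq_matI)
    fix i k assume "i < dim_row (F * D)" "k < dim_col (F * D)"
    then have ik: "i < ?N" "k < ?N" using car by auto
    have col: "col F k = vec ?N (\<lambda>i. w k (cell i))" using ik by (auto simp: F_def)
    have "(?B * F) $$ (i, k) = (?B *\<^sub>v vec ?N (\<lambda>i. w k (cell i))) $ i"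
      unfolding col[symmetric] using ik by (simp add: F_def bshift_def)
    also have "\<dots> = of_real E * w k (cell i) - schr_op (\<lambda>_. 0) (w k) (cell i)"
      unfolding w_def u_def v_def bshift_mult_bloch[OF bloch_plane_wave] using ik by simp
    also have "\<dots> = of_real (e k) * w k (cell i)"
      unfolding w_def schr_op_plane_wave by (simp add: e_def algebra_simps)
    also have "\<dots> = (F * D) $$ (i, k)"
    proof -
      have "(F * D) $$ (i, k) = (\<Sum>j<?N. F $$ (i, j) * D $$ (j, k))"
        using ik car by (simp add: scalar_prod_def lessThan_atLeast0)
      also have "\<dots> = (\<Sum>j<?N. if j = k then F $$ (i, k) * of_real (e k) else 0)"
        using ik by (intro sum.cong) (auto simp: D_def)
      also have "\<dots> = F $$ (i, k) * of_real (e k)" using ik by simp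
      finally show ?thesis using ik by (simp add: F_def)
    qed
    finally show "(?B * F) $$ (i, k) = (F * D) $$ (i, k)" .
  qed (use car in \<open>auto simp: bshift_def\<close>)
  then have "det ?B * det F = det F * det D"
    using det_mult[OF bshift_carrier car(1)] det_mult[OF car(1,3)] by metis
  moreover have "det F \<noteq> 0"
  proof -
    \<comment> \<open>Ratios of two plane waves with the same multipliers are characters of the
      cell, so their orthogonality reduces to sums of roots of unity in each coordinate.\<close>
    have "G * F = of_nat ?N \<cdot>\<^sub>m 1\<^sub>m ?N"
    proof (rule eq_matI)
      fix k k' assume "k < dim_row (of_nat ?N \<cdot>\<^sub>m 1\<^sub>m ?N)" "k' < dim_col (of_nat ?N \<cdot>\<^sub>m 1\<^sub>m ?N)"
      then have kk: "k < ?N" "k' < ?N" by auto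
      define s where "s = int (k' div q) - int (k div q)"
      define t where "t = int (k' mod q) - int (k mod q)"
      have st: "\<bar>s\<bar> < int p" "\<bar>t\<bar> < int q"
      proof -
        have "k div q < p" "k' div q < p" "k mod q < q" "k' mod q < q"
          using kk q_pos by (auto simp: less_mult_imp_div_less)
        then show "\<bar>s\<bar> < int p" "\<bar>t\<bar> < int q" unfolding s_def t_def by linarith+
      qed
      have "(G * F) $$ (k, k') = (\<Sum>i<?N. cnj (w k (cell i)) * w k' (cell i))"
        using kk car by (simp add: scalar_prod_def lessThan_atLeast0 G_def F_def)
      also have "\<dots> = (\<Sum>i<?N. cis (2 * pi * of_int s / real p) ^ (i div q) * cis (2 * pi * of_int t / real q) ^ (i mod q))"
      proof (intro sum.cong refl)
        fix i
        have "- (u k * real (i div q) + v k * real (i mod q)) + (u k' * real (i div q) + v k' * real (i mod q))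
          = real (i div q) * (2 * pi * of_int s / real p) + real (i mod q) * (2 * pi * of_int t / real q)"
          unfolding u_def v_def s_def t_def using p_pos q_pos by (simp add: field_simps)
        then show "cnj (w k (cell i)) * w k' (cell i)
          = cis (2 * pi * of_int s / real p) ^ (i div q) * cis (2 * pi * of_int t / real q) ^ (i mod q)"
          unfolding w_def plane_wave_def cell_def Complex.DeMoivre cis_mult cis_cnj fst_conv snd_conv of_int_of_nat_eq
          by (simp only:)
      qed
      also have "\<dots> = (\<Sum>(n, m)\<in>{..<p} \<times> {..<q}. cis (2 * pi * of_int s / real p) ^ n * cis (2 * pi * of_int t / real q) ^ m)"
        using sum.reindex_bij_betw[OF bij_betw_div_mod[OF q_pos], where g = "\<lambda>(n, m). cis (2 * pi * of_int s / real p) ^ n * cis (2 * pi * of_int t / real q) ^ m"]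
        by simp
      also have "\<dots> = (\<Sum>n<p. cis (2 * pi * of_int s / real p) ^ n) * (\<Sum>m<q. cis (2 * pi * of_int t / real q) ^ m)"
        by (simp add: sum_product sum.cartesian_product)
      also have "\<dots> = (if s = 0 \<and> t = 0 then of_nat ?N else 0)"
        unfolding sum_roots_of_unity[OF p_pos st(1)] sum_roots_of_unity[OF q_pos st(2)] by simp
      also have "s = 0 \<and> t = 0 \<longleftrightarrow> k = k'"
        by (metis div_mult_mod_eq eq_iff_diff_eq_0 of_nat_eq_iff s_def t_def)
      finally show "(G * F) $$ (k, k') = (of_nat ?N \<cdot>\<^sub>m 1\<^sub>m ?N) $$ (k, k')" using kk by simp
    qed (use car in auto)
    then have "det G * det F = of_nat ?N ^ ?N" using det_mult[OF car(2,1)] by simp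
    then show ?thesis using p_pos q_pos by (metis mult_eq_0_iff of_nat_eq_0_iff less_numeral_extra(3) power_not_zero)
  qed
  ultimately have "det ?B = det D" by simp
  also have "det D = (\<Prod>k<?N. of_real (e k))"
  proof -
    have "det D = prod_list (diag_mat D)"
      by (rule det_upper_triangular[OF _ car(3)]) (auto simp: D_def)
    also have "diag_mat D = map (\<lambda>k. of_real (e k)) [0..<?N]"
      unfolding diag_mat_def by (intro map_cong) (auto simp: D_def)
    also have "prod_list \<dots> = (\<Prod>k<?N. of_real (e k))"
      by (simp add: prod.distinct_set_conv_list[symmetric] lessThan_atLeast0)
    finally show ?thesis .
  qed
  also have "(\<Prod>k<?N. complex_of_real (e k)) = of_real (\<Prod>k<?N. e k)" by simp
  also have "(\<Prod>k<?N. e k) = free_prod p q E x y"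
    unfolding free_prod_def
    using prod.reindex_bij_betw[OF bij_betw_div_mod[OF q_pos, of p], where g = "\<lambda>(j, l). E - 2 * cos (x + 2 * pi * real j / real p) - 2 * cos (y + 2 * pi * real l / real q)"]
    by (simp add: e_def u_def v_def)
  finally show ?thesis by (simp add: bdet_def)
qed

end

section \<open>Continuity and uniform invertibility of Floquet matrices\<close>

text \<open>The Leibniz expansion is continuous in the entries; a sequence of counterexamples at
  distance 1/(m + 1) would converge entrywise to A.\<close>

lemma det_close:
  fixes A :: "complex mat"
  assumes A: "A \<in> carrier_mat n n" and e: "0 < \<epsilon>"
  shows "\<exists>d>0. \<forall>B\<in>carrier_mat n n. (\<forall>i<n. \<forall>j<n. cmod (B $$ (i, j) - A $$ (i, j)) \<le> d) \<longrightarrow> cmod (det B - det A) < \<epsilon>"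
proof (rule ccontr)
  assume neg: "\<not> ?thesis"
  from neg have neg': "\<exists>B\<in>carrier_mat n n. (\<forall>i<n. \<forall>j<n. cmod (B $$ (i, j) - A $$ (i, j)) \<le> d)
    \<and> \<not> cmod (det B - det A) < \<epsilon>" if "0 < d" for d
    using that by simp
  have "\<exists>B. B \<in> carrier_mat n n \<and> (\<forall>i<n. \<forall>j<n. cmod (B $$ (i, j) - A $$ (i, j)) \<le> inverse (real (Suc m)))
    \<and> \<epsilon> \<le> cmod (det B - det A)" for m
  proof -
    have "0 < inverse (real (Suc m))" by simp
    from neg'[OF this] show ?thesis unfolding not_less Bex_def .
  qed
  then obtain B where B: "\<And>m. B m \<in> carrier_mat n n"
    "\<And>m i j. i < n \<Longrightarrow> j < n \<Longrightarrow> cmod (B m $$ (i, j) - A $$ (i, j)) \<le> inverse (real (Suc m))"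
    "\<And>m. \<epsilon> \<le> cmod (det (B m) - det A)" by metis
  have lim: "(\<lambda>m. B m $$ (i, j)) \<longlonglongrightarrow> A $$ (i, j)" if "i < n" "j < n" for i j
    using tendsto_sandwich[OF _ _ tendsto_const LIMSEQ_inverse_real_of_nat, of "\<lambda>m. cmod (B m $$ (i, j) - A $$ (i, j))"]
      B(2)[OF that] by (simp add: tendsto_norm_zero_iff Lim_null[symmetric])
  have "(\<lambda>m. det (B m)) \<longlonglongrightarrow> det A"
    unfolding det_def'[OF A] det_def'[OF B(1)]
    by (intro tendsto_intros lim) (auto simp: permutes_in_image)
  then have "\<forall>\<^sub>F m in sequentially. cmod (det (B m) - det A) < \<epsilon>"
    using e unfolding tendsto_iff dist_norm by blast
  then obtain m where "cmod (det (B m) - det A) < \<epsilon>" by (auto simp: eventually_sequentially)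
  then show False using B(3)[of m] by linarith
qed

lemma det_norm_le:
  fixes A :: "complex mat"
  assumes A: "A \<in> carrier_mat n n" and le: "\<And>i j. i < n \<Longrightarrow> j < n \<Longrightarrow> cmod (A $$ (i, j)) \<le> M"
  shows "cmod (det A) \<le> fact n * M ^ n"
proof -
  have "cmod (det A) \<le> (\<Sum>\<pi> | \<pi> permutes {0..<n}. cmod (signof \<pi> * (\<Prod>i = 0..<n. A $$ (i, \<pi> i))))"
    unfolding det_def'[OF A] by (rule norm_sum)
  also have "\<dots> \<le> (\<Sum>\<pi> | \<pi> permutes {0..<n}. M ^ n)"
  proof (rule sum_mono)
    fix \<pi> assume "\<pi> \<in> {\<pi>. \<pi> permutes {0..<n}}"
    then have "\<pi> permutes {0..<n}" by simp
    then have "\<And>i. i < n \<Longrightarrow> \<pi> i < n" using permutes_in_image by fastforce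
    then have "(\<Prod>i = 0..<n. cmod (A $$ (i, \<pi> i))) \<le> (\<Prod>i = 0..<n. M)"
      by (intro prod_mono) (auto intro: le)
    moreover have "cmod (signof \<pi>) = 1" by (cases \<pi> rule: sign_cases) auto
    ultimately show "cmod (signof \<pi> * (\<Prod>i = 0..<n. A $$ (i, \<pi> i))) \<le> M ^ n"
      by (simp add: norm_mult prod_norm[symmetric])
  qed
  also have "\<dots> = fact n * M ^ n" by (simp add: card_permutations)
  finally show ?thesis .
qed

context period
begin

lemma bext_unit: "i < p * q \<Longrightarrow> bext a b (\<lambda>j. if j = k then 1 else 0) (cell i) = (if i = k then 1 else 0)"
  by (simp add: bext_cell)

text \<open>Energy and potential enter only on the diagonal, so the entries change by at most the
  sum of both perturbations; hence one d serves all small V.\<close>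

lemma bdet_close:
  assumes e: "0 < \<epsilon>"
  shows "\<exists>d>0. \<forall>V E. (\<forall>x. \<bar>V x\<bar> \<le> d) \<longrightarrow> \<bar>E - E0\<bar> \<le> d \<longrightarrow>
     cmod (bdet V a b (of_real E) - bdet (\<lambda>_. 0) a b (of_real E0)) < \<epsilon>"
proof -
  let ?A = "bshift (\<lambda>_. 0) a b (of_real E0)"
  obtain d where d: "0 < d" "\<And>B. B \<in> carrier_mat (p * q) (p * q) \<Longrightarrow>
      (\<And>i j. i < p * q \<Longrightarrow> j < p * q \<Longrightarrow> cmod (B $$ (i, j) - ?A $$ (i, j)) \<le> d) \<Longrightarrow> cmod (det B - det ?A) < \<epsilon>"
    using det_close[OF bshift_carrier e] by metis
  have "cmod (bdet V a b (of_real E) - bdet (\<lambda>_. 0) a b (of_real E0)) < \<epsilon>"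
    if V: "\<forall>x. \<bar>V x\<bar> \<le> d / 2" and E: "\<bar>E - E0\<bar> \<le> d / 2" for V E
    unfolding bdet_def
  proof (rule d(2)[OF bshift_carrier])
    fix i j assume ij: "i < p * q" "j < p * q"
    have "bshift V a b (of_real E) $$ (i, j) - ?A $$ (i, j)
      = (if i = j then of_real ((E - E0) - V (cell i)) else 0)"
      using ij by (simp add: bshift_def bmat_def schr_op_shift bext_unit)
    also have "cmod \<dots> \<le> d"
    proof -
      have "\<bar>(E - E0) - V (cell i)\<bar> \<le> d" using V[rule_format, of "cell i"] E by linarith
      then show ?thesis using d(1) by (simp only: norm_of_real split: if_splits) simp
    qed
    finally show "cmod (bshift V a b (of_real E) $$ (i, j) - ?A $$ (i, j)) \<le> d" .
  qed
  then show ?thesis using d(1) by (intro exI[of _ "d / 2"]) auto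
qed

lemma continuous_on_bdet:
  assumes "continuous_on S f" "continuous_on S g" "continuous_on S h"
    and nz: "\<And>s. s \<in> S \<Longrightarrow> f s \<noteq> 0" "\<And>s. s \<in> S \<Longrightarrow> g s \<noteq> 0"
  shows "continuous_on S (\<lambda>s. bdet V (f s) (g s) (h s))"
proof -
  have b: "continuous_on S (\<lambda>s. bext (f s) (g s) u x)" for u x
    unfolding bext_def using nz by (intro continuous_intros assms) auto
  have "continuous_on S (\<lambda>s. bshift V (f s) (g s) (h s) $$ (i, j))" if "i < p * q" "j < p * q" for i j
  proof -
    have "continuous_on S (\<lambda>s. (if i = j then h s else 0) - schr_op V (bext (f s) (g s) (\<lambda>l. if l = j then 1 else 0)) (cell i))"
      unfolding schr_op_shift using assms(3) by (cases "i = j") (auto intro!: continuous_intros b)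
    then show ?thesis using that by (simp add: bshift_def bmat_def)
  qed
  then show ?thesis unfolding bdet_def det_def'[OF bshift_carrier]
    by (intro continuous_intros) (auto simp: permutes_in_image)
qed

text \<open>Cramer's rule: det A times \<psi> is the adjugate applied to A \<psi>. By compactness
  the determinant stays at distance d from 0 on the torus, and the adjugate is uniformly bounded, so
  c does not depend on the quasimomentum.\<close>

lemma bloch_lower_bound:
  assumes V: "\<forall>x. \<bar>V x\<bar> \<le> C"
    and nz: "\<And>a b. cmod a = 1 \<Longrightarrow> cmod b = 1 \<Longrightarrow> bdet V a b z \<noteq> 0"
  obtains c where "0 < c" "\<And>a b \<psi>. cmod a = 1 \<Longrightarrow> cmod b = 1 \<Longrightarrow> bloch a b \<psi> \<Longrightarrow>
    c\<^sup>2 * (\<Sum>k<p * q. (cmod (\<psi> (cell k)))\<^sup>2) \<le> (\<Sum>k<p * q. (cmod (schr_sub V z \<psi> (cell k)))\<^sup>2)"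
proof -
  let ?N = "p * q"
  let ?T = "sphere 0 1 \<times> sphere 0 1 :: (complex \<times> complex) set"
  have C0: "0 \<le> C" using V[rule_format, of 0] by (rule order_trans[OF abs_ge_zero])
  have T: "compact ?T" by (intro compact_Times compact_sphere)
  have "(1, 1) \<in> ?T" by simp
  then have T0: "?T \<noteq> {}" by blast
  have "continuous_on ?T (\<lambda>s. cmod (bdet V (fst s) (snd s) z))"
    by (intro continuous_intros continuous_on_bdet) auto
  from continuous_attains_inf[OF T T0 this]
  obtain s0 where s0: "s0 \<in> ?T" "\<And>s. s \<in> ?T \<Longrightarrow> cmod (bdet V (fst s0) (snd s0) z) \<le> cmod (bdet V (fst s) (snd s) z)"
    by blast
  define d where "d = cmod (bdet V (fst s0) (snd s0) z)"
  have d: "0 < d" using nz s0(1) by (auto simp: d_def)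
  have dle: "d \<le> cmod (bdet V a b z)" if "cmod a = 1" "cmod b = 1" for a b
    using s0(2)[of "(a, b)"] that by (simp add: d_def)
  \<comment> \<open>m bounds an entry: z, four neighbour terms and V. Cofactors are determinants of
    size N - 1 in such entries; the added 1 in \<open>M\<close> makes it positive.\<close>
  define m where "m = cmod z + 4 + C"
  define M where "M = fact (?N - 1) * m ^ (?N - 1) + 1"
  have m0: "0 \<le> m" using C0 by (simp add: m_def)
  then have M: "0 < M" unfolding M_def by (simp add: add_nonneg_pos)
  \<comment> \<open>One square root of N comes from Cauchy-Schwarz for \<open>W\<close>, the other
    from summing the pointwise bound over N sites.\<close>
  define c where "c = d / (M * real ?N)"
  have N: "0 < ?N" using p_pos q_pos by simp
  have c: "0 < c" unfolding c_def using d M N by simp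
  have main: "c\<^sup>2 * (\<Sum>k<?N. (cmod (\<psi> (cell k)))\<^sup>2) \<le> (\<Sum>k<?N. (cmod (schr_sub V z \<psi> (cell k)))\<^sup>2)"
    if ab: "cmod a = 1" "cmod b = 1" and \<psi>: "bloch a b \<psi>" for a b \<psi>
  proof -
    let ?A = "bshift V a b z"
    have ent: "cmod (?A $$ (i, j)) \<le> m" if ij: "i < ?N" "j < ?N" for i j
    proof -
      let ?e = "bext a b (\<lambda>l. if l = j then 1 else 0)"
      have e: "cmod (?e x) \<le> 1" for x by (simp add: bext_def norm_mult norm_power_int ab)
      have "cmod (complex_of_real (V (cell i)) * ?e (cell i)) \<le> C * 1"
        unfolding norm_mult by (intro mult_mono e) (simp_all add: C0 V[rule_format])
      then have "cmod (schr_op V ?e (cell i)) \<le> 1 + 1 + 1 + 1 + C"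
        unfolding schr_op_shift by (intro norm_triangle_mono e) auto
      then have "cmod ((if i = j then z else 0) - schr_op V ?e (cell i)) \<le> cmod z + (1 + 1 + 1 + 1 + C)"
        by (intro order_trans[OF norm_triangle_ineq4] add_mono) auto
      then show ?thesis using ij by (simp add: bshift_def bmat_def m_def)
    qed
    have adj: "cmod (adj_mat ?A $$ (i, j)) \<le> M" if ij: "i < ?N" "j < ?N" for i j
    proof -
      have "cmod (adj_mat ?A $$ (i, j)) = cmod (det (mat_delete ?A j i))"
      proof -
        have "adj_mat ?A $$ (i, j) = cofactor ?A j i" using ij by (simp add: adj_mat_def bshift_def)
        then show ?thesis by (simp add: cofactor_def norm_mult norm_power)
      qed
      also have "\<dots> \<le> fact (?N - 1) * m ^ (?N - 1)"
      proof (rule det_norm_le[OF mat_delete_carrier[OF bshift_carrier]])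
        fix r s assume rs: "r < ?N - 1" "s < ?N - 1"
        have "mat_delete ?A j i $$ (r, s) = ?A $$ (insert_index j r, insert_index i s)"
          using mat_delete_index[of ?A "?N - 1" j i r s] rs ij N by simp
        then show "cmod (mat_delete ?A j i $$ (r, s)) \<le> m"
          using ent[of "insert_index j r" "insert_index i s"] rs by (auto simp: insert_index_def)
      qed
      finally show ?thesis by (simp add: M_def)
    qed
    define v where "v = vec ?N (\<lambda>k. \<psi> (cell k))"
    define w where "w k = cmod (schr_sub V z \<psi> (cell k))" for k
    define W where "W = (\<Sum>k<?N. w k)"
    have comp: "d * cmod (\<psi> (cell i)) \<le> M * W" if i: "i < ?N" for i
    proof -
      have vc: "v \<in> carrier_vec ?N" by (simp add: v_def)
      have "(det ?A \<cdot>\<^sub>m 1\<^sub>m ?N) *\<^sub>v v = det ?A \<cdot>\<^sub>v v"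
      proof (rule eq_vecI)
        fix i assume "i < dim_vec (det ?A \<cdot>\<^sub>v v)"
        then have i: "i < ?N" by (simp add: v_def)
        have "((det ?A \<cdot>\<^sub>m 1\<^sub>m ?N) *\<^sub>v v) $ i = (\<Sum>j<?N. det ?A * (if j = i then 1 else 0) * v $ j)"
          using i vc by (simp add: scalar_prod_def lessThan_atLeast0)
        also have "\<dots> = (\<Sum>j<?N. if i = j then det ?A * v $ j else 0)" by (intro sum.cong) auto
        finally have "((det ?A \<cdot>\<^sub>m 1\<^sub>m ?N) *\<^sub>v v) $ i = (\<Sum>j<?N. if i = j then det ?A * v $ j else 0)" .
        then show "((det ?A \<cdot>\<^sub>m 1\<^sub>m ?N) *\<^sub>v v) $ i = (det ?A \<cdot>\<^sub>v v) $ i" using i vc by simp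
      qed (simp add: v_def)
      then have "adj_mat ?A *\<^sub>v (?A *\<^sub>v v) = det ?A \<cdot>\<^sub>v v"
        using assoc_mult_mat_vec[OF adj_mat(1)[OF bshift_carrier] bshift_carrier vc, of V a b z V a b z]
          adj_mat(3)[OF bshift_carrier, of V a b z] by simp
      then have "det ?A * \<psi> (cell i) = (adj_mat ?A *\<^sub>v (?A *\<^sub>v v)) $ i"
        using i by (simp add: v_def)
      also have "\<dots> = (\<Sum>j<?N. adj_mat ?A $$ (i, j) * (z * \<psi> (cell j) - schr_op V \<psi> (cell j)))"
        unfolding v_def bshift_mult_bloch[OF \<psi>] using i adj_mat(1)[OF bshift_carrier, of V a b z]
        by (simp add: scalar_prod_def lessThan_atLeast0)
      finally have "cmod (det ?A) * cmod (\<psi> (cell i)) = cmod (\<Sum>j<?N. adj_mat ?A $$ (i, j) * (z * \<psi> (cell j) - schr_op V \<psi> (cell j)))"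
        unfolding norm_mult[symmetric] by (rule arg_cong)
      also have "\<dots> \<le> (\<Sum>j<?N. cmod (adj_mat ?A $$ (i, j) * (z * \<psi> (cell j) - schr_op V \<psi> (cell j))))"
        by (rule norm_sum)
      also have "\<dots> \<le> (\<Sum>j<?N. M * w j)"
        unfolding norm_mult w_def schr_sub_def using adj[OF i] M
        by (intro sum_mono mult_mono) (auto simp: norm_minus_commute)
      also have "\<dots> = M * W" by (simp add: W_def sum_distrib_left)
      finally show ?thesis
        using mult_right_mono[OF dle[OF ab] norm_ge_zero[of "\<psi> (cell i)"]] unfolding bdet_def by linarith
    qed
    have "W\<^sup>2 \<le> real ?N * (\<Sum>k<?N. (w k)\<^sup>2)"
      unfolding W_def using sum_squared_le_sum_of_squares[of w "{..<?N}"] by (simp add: mult.commute)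
    then have W2: "M\<^sup>2 * W\<^sup>2 \<le> M\<^sup>2 * (real ?N * (\<Sum>k<?N. (w k)\<^sup>2))" by (intro mult_left_mono) auto
    have "d\<^sup>2 * (\<Sum>k<?N. (cmod (\<psi> (cell k)))\<^sup>2) = (\<Sum>k<?N. (d * cmod (\<psi> (cell k)))\<^sup>2)"
      by (simp add: sum_distrib_left power_mult_distrib)
    also have "\<dots> \<le> (\<Sum>k<?N. (M * W)\<^sup>2)"
      using d by (intro sum_mono power_mono comp) auto
    also have "\<dots> = real ?N * (M\<^sup>2 * W\<^sup>2)" by (simp add: power_mult_distrib)
    also have "\<dots> \<le> real ?N * (M\<^sup>2 * (real ?N * (\<Sum>k<?N. (w k)\<^sup>2)))" by (intro mult_left_mono W2) auto
    also have "\<dots> = (M * real ?N)\<^sup>2 * (\<Sum>k<?N. (w k)\<^sup>2)" by (simp add: power2_eq_square)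
    finally have *: "d\<^sup>2 * (\<Sum>k<?N. (cmod (\<psi> (cell k)))\<^sup>2) \<le> (M * real ?N)\<^sup>2 * (\<Sum>k<?N. (w k)\<^sup>2)" .
    have MN: "0 < (M * real ?N)\<^sup>2" using M N by simp
    show ?thesis unfolding c_def power_divide using * MN
      by (simp add: w_def[symmetric] pos_divide_le_eq mult.commute)
  qed
  show thesis by (rule that[OF c main])
qed

end

section \<open>Parseval identity and the spectrum\<close>

lemma infsum_finite_support:
  fixes f :: "'a \<Rightarrow> 'b::{comm_monoid_add, t2_space}"
  assumes "finite B" "\<And>x. x \<notin> B \<Longrightarrow> f x = 0"
  shows "infsum f UNIV = sum f B"
proof -
  have "infsum f UNIV = infsum f B" using assms(2) by (intro infsum_cong_neutral) auto
  then show ?thesis using assms(1) by simp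
qed

text \<open>Frequencies in the support differ by at most 2K < L, so the L by L grid of roots of
  unity still separates them: the quadrature is exact and replaces integration over the
  torus.\<close>

lemma parseval_finite:
  fixes c :: "int \<times> int \<Rightarrow> complex" and K L :: nat
  assumes L: "2 * K < L" and c: "\<And>x. x \<notin> {-int K..int K} \<times> {-int K..int K} \<Longrightarrow> c x = 0"
  shows "(\<Sum>i<L. \<Sum>j<L. (cmod (\<Sum>\<^sub>\<infinity>x. cis (2 * pi * real i / real L) powi (- fst x) * cis (2 * pi * real j / real L) powi (- snd x) * c x))\<^sup>2)
    = (real L)\<^sup>2 * (\<Sum>\<^sub>\<infinity>x. (cmod (c x))\<^sup>2)"
proof -
  let ?B = "{-int K..int K} \<times> {-int K..int K}"
  define e where "e i j x = cis (2 * pi * real i / real L) powi (- fst x) * cis (2 * pi * real j / real L) powi (- snd x)"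
    for i j :: nat and x :: "int \<times> int"
  have L0: "0 < L" using L by simp
  have orth: "(\<Sum>i<L. \<Sum>j<L. e i j x * cnj (e i j y)) = (if x = y then (of_nat L)\<^sup>2 else 0)"
    if x: "x \<in> ?B" and y: "y \<in> ?B" for x y
  proof -
    define s where "s = fst y - fst x"
    define t where "t = snd y - snd x"
    have st: "\<bar>s\<bar> < int L" "\<bar>t\<bar> < int L" using x y L by (auto simp: s_def t_def)
    have ee: "e i j x * cnj (e i j y) = cis (2 * pi * of_int s / real L) ^ i * cis (2 * pi * of_int t / real L) ^ j" for i j
    proof -
      have "of_int (- fst x) * (2 * pi * real i / real L) + of_int (- snd x) * (2 * pi * real j / real L)
         + - (of_int (- fst y) * (2 * pi * real i / real L) + of_int (- snd y) * (2 * pi * real j / real L))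
        = real i * (2 * pi * of_int s / real L) + real j * (2 * pi * of_int t / real L)"
        unfolding s_def t_def using L0 by (simp add: field_simps)
      then show ?thesis unfolding e_def cis_power_int Complex.DeMoivre cis_mult cis_cnj by (simp only:)
    qed
    have "(\<Sum>i<L. \<Sum>j<L. e i j x * cnj (e i j y))
       = (\<Sum>i<L. cis (2 * pi * of_int s / real L) ^ i) * (\<Sum>j<L. cis (2 * pi * of_int t / real L) ^ j)"
      unfolding ee by (simp add: sum_product)
    also have "\<dots> = (if s = 0 \<and> t = 0 then (of_nat L)\<^sup>2 else 0)"
      unfolding sum_roots_of_unity[OF L0 st(1)] sum_roots_of_unity[OF L0 st(2)] by (simp add: power2_eq_square)
    also have "s = 0 \<and> t = 0 \<longleftrightarrow> x = y" by (auto simp: s_def t_def prod_eq_iff)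
    finally show ?thesis .
  qed
  have "complex_of_real (\<Sum>i<L. \<Sum>j<L. (cmod (\<Sum>\<^sub>\<infinity>x. e i j x * c x))\<^sup>2)
    = (\<Sum>i<L. \<Sum>j<L. complex_of_real ((cmod (\<Sum>x\<in>?B. e i j x * c x))\<^sup>2))"
    by (subst infsum_finite_support[where B = ?B]) (use c in auto)
  also have "\<dots> = (\<Sum>i<L. \<Sum>j<L. (\<Sum>x\<in>?B. \<Sum>y\<in>?B. (e i j x * cnj (e i j y)) * (c x * cnj (c y))))"
    unfolding complex_norm_square cnj_sum sum_product by (simp only: complex_cnj_mult mult_ac)
  also have "\<dots> = (\<Sum>x\<in>?B. \<Sum>y\<in>?B. (\<Sum>i<L. \<Sum>j<L. (e i j x * cnj (e i j y)) * (c x * cnj (c y))))"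
    by (subst (2) sum.swap, subst sum.swap, rule sum.cong[OF refl],
      subst (2) sum.swap, subst sum.swap, rule refl)
  also have "\<dots> = (\<Sum>x\<in>?B. \<Sum>y\<in>?B. (\<Sum>i<L. \<Sum>j<L. e i j x * cnj (e i j y)) * (c x * cnj (c y)))"
    by (simp only: sum_distrib_right)
  also have "\<dots> = (\<Sum>x\<in>?B. \<Sum>y\<in>?B. if x = y then (of_nat L)\<^sup>2 * (c x * cnj (c x)) else 0)"
    by (intro sum.cong refl) (auto simp: orth)
  also have "\<dots> = (\<Sum>x\<in>?B. (of_nat L)\<^sup>2 * (c x * cnj (c x)))" by (intro sum.cong refl) simp
  also have "\<dots> = complex_of_real ((real L)\<^sup>2 * (\<Sum>x\<in>?B. (cmod (c x))\<^sup>2))"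
    by (simp only: of_real_mult of_real_sum of_real_power of_real_of_nat_eq complex_norm_square[symmetric] sum_distrib_left)
  also have "(\<Sum>x\<in>?B. (cmod (c x))\<^sup>2) = (\<Sum>\<^sub>\<infinity>x. (cmod (c x))\<^sup>2)"
    by (rule infsum_finite_support[symmetric]) (use c in auto)
  finally show ?thesis unfolding of_real_eq_iff e_def .
qed

section \<open>The Floquet transform\<close>

context period
begin

definition translate :: "int \<times> int \<Rightarrow> int \<times> int \<Rightarrow> int \<times> int" where
  "translate x s = (fst x + fst s * int p, snd x + snd s * int q)"

lemma inj_translate: "inj (translate x)"
  using p_pos q_pos by (auto intro!: injI simp: translate_def prod_eq_iff)

lemma finite_translate_support: "finite {x. \<psi> x \<noteq> 0} \<Longrightarrow> finite {s. \<psi> (translate x s) \<noteq> 0}"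
  using finite_vimageI[OF _ inj_translate, of "{x. \<psi> x \<noteq> 0}"] by (simp add: vimage_def)

lemma translate_shift: "translate (x + d) s = translate x s + d"
  by (simp add: translate_def prod_eq_iff)

text \<open>The Gelfand transform along the period lattice; the negative exponents make its values
  Bloch functions with multipliers a and b.\<close>

definition floquet :: "complex \<Rightarrow> complex \<Rightarrow> (int \<times> int \<Rightarrow> complex) \<Rightarrow> int \<times> int \<Rightarrow> complex" where
  "floquet a b \<psi> x = (\<Sum>\<^sub>\<infinity>s. a powi (- fst s) * b powi (- snd s) * \<psi> (translate x s))"

lemma floquet_summable:
  fixes a b :: complex
  assumes "finite {x. \<psi> x \<noteq> 0}"
  shows "(\<lambda>s. a powi (- fst s) * b powi (- snd s) * \<psi> (translate x s)) summable_on UNIV"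
proof (rule finite_nonzero_values_imp_summable_on, rule finite_subset)
  show "{s \<in> UNIV. a powi (- fst s) * b powi (- snd s) * \<psi> (translate x s) \<noteq> 0} \<subseteq> {s. \<psi> (translate x s) \<noteq> 0}"
    by auto
qed (rule finite_translate_support[OF assms])

lemma bloch_floquet:
  assumes ab: "a \<noteq> 0" "b \<noteq> 0"
  shows "bloch a b (floquet a b \<psi>)"
  unfolding bloch_def
proof (intro allI)
  fix n m s t :: int
  have "floquet a b \<psi> (n, m) = (\<Sum>\<^sub>\<infinity>r. a powi (- fst (r + (s, t))) * b powi (- snd (r + (s, t))) * \<psi> (translate (n, m) (r + (s, t))))"
    unfolding floquet_def
    by (rule infsum_reindex_bij_betw[OF bij_shift[of "(s, t)"], symmetric,
      of "\<lambda>r. a powi (- fst r) * b powi (- snd r) * \<psi> (translate (n, m) r)"])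
  also have "\<dots> = (\<Sum>\<^sub>\<infinity>r. (a powi (- s) * b powi (- t)) * (a powi (- fst r) * b powi (- snd r) * \<psi> (translate (n + s * int p, m + t * int q) r)))"
  proof (rule infsum_cong)
    fix r :: "int \<times> int"
    have 1: "translate (n, m) (r + (s, t)) = translate (n + s * int p, m + t * int q) r"
      by (simp add: translate_def algebra_simps)
    have "a powi (- fst (r + (s, t))) = a powi (- s) * a powi (- fst r)"
      "b powi (- snd (r + (s, t))) = b powi (- t) * b powi (- snd r)"
      using ab by (simp_all add: power_int_add[symmetric] minus_add_distrib add.commute)
    then show "a powi (- fst (r + (s, t))) * b powi (- snd (r + (s, t))) * \<psi> (translate (n, m) (r + (s, t))) = (a powi (- s) * b powi (- t)) * (a powi (- fst r) * b powi (- snd r) * \<psi> (translate (n + s * int p, m + t * int q) r))"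
      unfolding 1 by (simp only: mult_ac)
  qed
  also have "\<dots> = (a powi (- s) * b powi (- t)) * floquet a b \<psi> (n + s * int p, m + t * int q)"
    unfolding floquet_def by (rule infsum_cmult_right')
  finally show "floquet a b \<psi> (n + s * int p, m + t * int q) = a powi s * b powi t * floquet a b \<psi> (n, m)"
    using ab by (simp add: power_int_minus field_simps)
qed

lemma finite_support_shift:
  fixes d :: "int \<times> int"
  assumes "finite {x. \<psi> x \<noteq> (0::complex)}"
  shows "finite {x. \<psi> (x + d) \<noteq> 0}"
  using finite_vimageI[OF assms, of "\<lambda>x. x + d"] by (simp add: vimage_def inj_on_def)

lemma finite_support_schr_sub:
  assumes "finite {x. \<psi> x \<noteq> 0}"
  shows "finite {x. schr_sub V z \<psi> x \<noteq> 0}"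
proof (rule finite_subset)
  show "{x. schr_sub V z \<psi> x \<noteq> 0} \<subseteq> {x. \<psi> (x + (-1,0)) \<noteq> 0} \<union> {x. \<psi> (x + (1,0)) \<noteq> 0}
     \<union> {x. \<psi> (x + (0,-1)) \<noteq> 0} \<union> {x. \<psi> (x + (0,1)) \<noteq> 0} \<union> {x. \<psi> x \<noteq> 0}"
    unfolding schr_sub_shift by auto
  show "finite \<dots>" using assms by (intro finite_UnI finite_support_shift)
qed

lemma floquet_shift: "floquet a b \<psi> (x + d) = floquet a b (\<lambda>y. \<psi> (y + d)) x"
  by (simp add: floquet_def translate_shift)

lemma floquet_add:
  assumes "finite {x. \<phi> x \<noteq> 0}" "finite {x. \<psi> x \<noteq> 0}"
  shows "floquet a b (\<lambda>y. \<phi> y + \<psi> y) x = floquet a b \<phi> x + floquet a b \<psi> x"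
  unfolding floquet_def by (simp add: distrib_left infsum_add floquet_summable assms)

text \<open>V is constant along the period lattice and the transform commutes with shifts; finite
  supports allow summing term by term.\<close>

lemma floquet_schr_sub:
  assumes V: "periodic_pq (int p) (int q) V" and \<psi>: "finite {x. \<psi> x \<noteq> 0}"
  shows "floquet a b (schr_sub V z \<psi>) x = schr_sub V z (floquet a b \<psi>) x"
proof -
  have Vt: "V (translate x s) = V x" for x s
    unfolding translate_def by (simp add: periodic_multiple[OF V])
  have "finite {x. (complex_of_real (V x) - z) * \<psi> x \<noteq> 0}" by (rule finite_subset[OF _ \<psi>]) auto
  note f = finite_support_shift[OF \<psi>] this
  have un: "finite {x. \<phi> x + \<eta> x \<noteq> 0}" if "finite {x. \<phi> x \<noteq> 0}" "finite {x. \<eta> x \<noteq> 0}" for \<phi> \<eta> :: "int \<times> int \<Rightarrow> complex"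
    by (rule finite_subset[OF _ finite_UnI[OF that]]) auto
  have eq: "schr_sub V z \<psi> = (\<lambda>x. \<psi> (x + (-1,0)) + \<psi> (x + (1,0)) + \<psi> (x + (0,-1)) + \<psi> (x + (0,1))
     + (complex_of_real (V x) - z) * \<psi> x)" by (rule ext) (rule schr_sub_shift)
  have m: "floquet a b (\<lambda>x. (complex_of_real (V x) - z) * \<psi> x) x = (complex_of_real (V x) - z) * floquet a b \<psi> x"
    unfolding floquet_def Vt mult.left_commute[of _ "complex_of_real (V x) - z"] by (rule infsum_cmult_right')
  show ?thesis unfolding eq schr_sub_shift floquet_shift m[symmetric]
    by (simp only: floquet_add f un)
qed

lemma bij_cell_translate: "bij_betw (\<lambda>(k, s). translate (cell k) s) ({..<p * q} \<times> UNIV) UNIV"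
proof -
  have a: "(idx (translate (cell k) r), fst (translate (cell k) r) div int p, snd (translate (cell k) r) div int q) = (k, r)"
    if k: "k < p * q" for k r
  proof -
    have 1: "idx (translate (cell k) r) = idx (cell k)"
      unfolding idx_def translate_def by simp
    show ?thesis unfolding 1 idx_cell[OF k] using cell_div[OF k] p_pos q_pos by (simp add: translate_def)
  qed
  have b: "translate (cell (idx x)) (fst x div int p, snd x div int q) = x" for x
    by (simp add: cell_idx translate_def)
  show ?thesis
    by (rule bij_betw_byWitness[where f' = "\<lambda>x. (idx x, (fst x div int p, snd x div int q))"])
      (use a b idx_less in auto)
qed

lemma l2norm_cells:
  assumes \<psi>: "finite {x. \<psi> x \<noteq> 0}"
  shows "(l2norm \<psi>)\<^sup>2 = (\<Sum>k<p * q. \<Sum>\<^sub>\<infinity>s. (cmod (\<psi> (translate (cell k) s)))\<^sup>2)"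
proof -
  define f where "f = (\<lambda>(k, s). (cmod (\<psi> (translate (cell k) s)))\<^sup>2)"
  have "(\<lambda>x. (cmod (\<psi> x))\<^sup>2) summable_on UNIV"
    by (rule finite_nonzero_values_imp_summable_on) (use \<psi> in simp)
  then have s: "f summable_on {..<p * q} \<times> UNIV"
    using summable_on_reindex_bij_betw[OF bij_cell_translate, of "\<lambda>x. (cmod (\<psi> x))\<^sup>2"]
    unfolding f_def by (simp add: case_prod_unfold)
  have "(l2norm \<psi>)\<^sup>2 = infsum f ({..<p * q} \<times> UNIV)"
    unfolding l2norm_square f_def
    using infsum_reindex_bij_betw[OF bij_cell_translate, of "\<lambda>x. (cmod (\<psi> x))\<^sup>2"] by (simp add: case_prod_unfold)
  also have "\<dots> = (\<Sum>\<^sub>\<infinity>k\<in>{..<p * q}. \<Sum>\<^sub>\<infinity>s. f (k, s))"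
    by (rule infsum_Sigma_banach[OF s, symmetric])
  finally show ?thesis by (simp add: f_def)
qed

text \<open>Holding for all large L, it lets a function and its image under H - z share one
  grid.\<close>

lemma floquet_parseval:
  assumes \<psi>: "finite {x. \<psi> x \<noteq> 0}"
  shows "\<exists>L0. \<forall>L>L0. (\<Sum>i<L. \<Sum>j<L. \<Sum>k<p * q.
      (cmod (floquet (cis (2 * pi * real i / real L)) (cis (2 * pi * real j / real L)) \<psi> (cell k)))\<^sup>2)
    = (real L)\<^sup>2 * (l2norm \<psi>)\<^sup>2"
proof -
  define S where "S = (\<Union>k<p * q. {s. \<psi> (translate (cell k) s) \<noteq> 0})"
  have "finite S" unfolding S_def by (auto intro: finite_translate_support[OF \<psi>])
  then have "finite ((\<lambda>s. nat \<bar>fst s\<bar> + nat \<bar>snd s\<bar>) ` S)" by simp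
  then obtain K where K: "\<And>s. s \<in> S \<Longrightarrow> nat \<bar>fst s\<bar> + nat \<bar>snd s\<bar> \<le> K"
    by (meson finite_nat_set_iff_bounded_le imageI)
  have zero: "\<psi> (translate (cell k) s) = 0" if "k < p * q" "s \<notin> {-int K..int K} \<times> {-int K..int K}" for k s
  proof (rule ccontr)
    assume "\<psi> (translate (cell k) s) \<noteq> 0"
    then have "s \<in> S" using that(1) by (auto simp: S_def)
    from K[OF this] have "nat \<bar>fst s\<bar> + nat \<bar>snd s\<bar> \<le> K" .
    then have "fst s \<in> {-int K..int K}" "snd s \<in> {-int K..int K}" by auto
    then show False using that(2) by (simp add: mem_Times_iff)
  qed
  show ?thesis
  proof (intro exI allI impI)
    fix L assume L: "2 * K < L"
    let ?F = "\<lambda>i j k. (cmod (floquet (cis (2 * pi * real i / real L)) (cis (2 * pi * real j / real L)) \<psi> (cell k)))\<^sup>2"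
    have "(\<Sum>i<L. \<Sum>j<L. \<Sum>k<p * q. ?F i j k) = (\<Sum>i<L. \<Sum>k<p * q. \<Sum>j<L. ?F i j k)"
      by (rule sum.cong[OF refl sum.swap])
    also have "\<dots> = (\<Sum>k<p * q. \<Sum>i<L. \<Sum>j<L. ?F i j k)" by (rule sum.swap)
    also have "\<dots> = (\<Sum>k<p * q. (real L)\<^sup>2 * (\<Sum>\<^sub>\<infinity>s. (cmod (\<psi> (translate (cell k) s)))\<^sup>2))"
      unfolding floquet_def by (intro sum.cong refl parseval_finite[OF L] zero) auto
    also have "\<dots> = (real L)\<^sup>2 * (l2norm \<psi>)\<^sup>2" by (simp only: l2norm_cells[OF \<psi>] sum_distrib_left)
    finally show "(\<Sum>i<L. \<Sum>j<L. \<Sum>k<p * q.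
      (cmod (floquet (cis (2 * pi * real i / real L)) (cis (2 * pi * real j / real L)) \<psi> (cell k)))\<^sup>2)
      = (real L)\<^sup>2 * (l2norm \<psi>)\<^sup>2" .
  qed
qed

text \<open>The fibre bounds have a common constant, so they add up over the grid; density then
  removes the finite support.\<close>

lemma l2_lower_bound:
  assumes per: "periodic_pq (int p) (int q) V" and V: "\<forall>x. \<bar>V x\<bar> \<le> C"
    and nz: "\<And>a b. cmod a = 1 \<Longrightarrow> cmod b = 1 \<Longrightarrow> bdet V a b z \<noteq> 0"
  shows "\<exists>c>0. \<forall>\<psi>\<in>l2. c * l2norm \<psi> \<le> l2norm (schr_sub V z \<psi>)"
proof -
  obtain c where c: "0 < c" "\<And>a b \<psi>. cmod a = 1 \<Longrightarrow> cmod b = 1 \<Longrightarrow> bloch a b \<psi> \<Longrightarrow>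
    c\<^sup>2 * (\<Sum>k<p * q. (cmod (\<psi> (cell k)))\<^sup>2) \<le> (\<Sum>k<p * q. (cmod (schr_sub V z \<psi> (cell k)))\<^sup>2)"
    using bloch_lower_bound[OF V nz] by blast
  have "c * l2norm \<psi> \<le> l2norm (schr_sub V z \<psi>)" if \<psi>: "finite {x. \<psi> x \<noteq> 0}" for \<psi>
  proof -
    let ?A = "schr_sub V z \<psi>"
    have A: "finite {x. ?A x \<noteq> 0}" by (rule finite_support_schr_sub[OF \<psi>])
    let ?w = "\<lambda>L i. cis (2 * pi * real i / real L)"
    obtain L1 where L1: "\<And>L. L1 < L \<Longrightarrow> (\<Sum>i<L. \<Sum>j<L. \<Sum>k<p * q. (cmod (floquet (?w L i) (?w L j) \<psi> (cell k)))\<^sup>2)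
      = (real L)\<^sup>2 * (l2norm \<psi>)\<^sup>2" using floquet_parseval[OF \<psi>] by blast
    obtain L2 where L2: "\<And>L. L2 < L \<Longrightarrow> (\<Sum>i<L. \<Sum>j<L. \<Sum>k<p * q. (cmod (floquet (?w L i) (?w L j) ?A (cell k)))\<^sup>2)
      = (real L)\<^sup>2 * (l2norm ?A)\<^sup>2" using floquet_parseval[OF A] by blast
    define L where "L = Suc (max L1 L2)"
    have L: "L1 < L" "L2 < L" "0 < L" by (auto simp: L_def)
    have "(real L)\<^sup>2 * (c * l2norm \<psi>)\<^sup>2 = c\<^sup>2 * ((real L)\<^sup>2 * (l2norm \<psi>)\<^sup>2)" by (simp add: power_mult_distrib)
    also have "\<dots> = (\<Sum>i<L. \<Sum>j<L. c\<^sup>2 * (\<Sum>k<p * q. (cmod (floquet (?w L i) (?w L j) \<psi> (cell k)))\<^sup>2))"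
      unfolding L1[OF L(1), symmetric] by (simp only: sum_distrib_left)
    also have "\<dots> \<le> (\<Sum>i<L. \<Sum>j<L. \<Sum>k<p * q. (cmod (schr_sub V z (floquet (?w L i) (?w L j) \<psi>) (cell k)))\<^sup>2)"
      by (intro sum_mono c(2)[OF _ _ bloch_floquet]) auto
    also have "\<dots> = (real L)\<^sup>2 * (l2norm ?A)\<^sup>2"
      unfolding L2[OF L(2), symmetric] floquet_schr_sub[OF per \<psi>] ..
    finally have "(c * l2norm \<psi>)\<^sup>2 \<le> (l2norm ?A)\<^sup>2" using L(3) by simp
    then show ?thesis by (rule power2_le_imp_le) simp
  qed
  then show ?thesis using l2_lower_bound_from_finite[OF V _ less_imp_le[OF c(1)], of z] c(1) by blast
qed

lemma spectrum_H_iff: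
  assumes per: "periodic_pq (int p) (int q) V" and V: "\<forall>x. \<bar>V x\<bar> \<le> C"
  shows "z \<in> spectrum_H V \<longleftrightarrow> (\<exists>a b. cmod a = 1 \<and> cmod b = 1 \<and> bdet V a b z = 0)"
proof
  assume "z \<in> spectrum_H V"
  show "\<exists>a b. cmod a = 1 \<and> cmod b = 1 \<and> bdet V a b z = 0"
  proof (rule ccontr)
    assume neg: "\<not> ?thesis"
    then have nz: "bdet V a b z \<noteq> 0" if "cmod a = 1" "cmod b = 1" for a b using that by blast
    \<comment> \<open>The lower bound at \<open>cnj z\<close> makes the adjoint injective in
      \<open>resolvent_setI\<close>. Determinant zeros are real, so one at \<open>cnj z\<close>
      would be one at z.\<close>
    have nz': "bdet V a b (cnj z) \<noteq> 0" if "cmod a = 1" "cmod b = 1" for a b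
    proof
      assume 0: "bdet V a b (cnj z) = 0"
      from bdet_eq_0_spectrum(2)[OF per V that this] have "cnj z = z" by (simp add: complex_eq_iff)
      then show False using 0 nz[OF that] by simp
    qed
    obtain c where c: "0 < c" "\<And>\<psi>. \<psi> \<in> l2 \<Longrightarrow> c * l2norm \<psi> \<le> l2norm (schr_sub V z \<psi>)"
      using l2_lower_bound[OF per V nz] by blast
    obtain c' where c': "0 < c'" "\<And>\<psi>. \<psi> \<in> l2 \<Longrightarrow> c' * l2norm \<psi> \<le> l2norm (schr_sub V (cnj z) \<psi>)"
      using l2_lower_bound[OF per V nz'] by blast
    have "z \<in> resolvent_set V"
    proof (rule resolvent_setI[OF V])
      show "0 < min c c'" using c(1) c'(1) by simp
      fix \<psi> assume "\<psi> \<in> l2"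
      show "min c c' * l2norm \<psi> \<le> l2norm (schr_sub V z \<psi>)"
        using c(2)[OF \<open>\<psi> \<in> l2\<close>] mult_right_mono[of "min c c'" c "l2norm \<psi>"] by simp
      show "min c c' * l2norm \<psi> \<le> l2norm (schr_sub V (cnj z) \<psi>)"
        using c'(2)[OF \<open>\<psi> \<in> l2\<close>] mult_right_mono[of "min c c'" c' "l2norm \<psi>"] by simp
    qed
    then show False using \<open>z \<in> spectrum_H V\<close> by (simp add: spectrum_H_def)
  qed
next
  assume "\<exists>a b. cmod a = 1 \<and> cmod b = 1 \<and> bdet V a b z = 0"
  then show "z \<in> spectrum_H V" using bdet_eq_0_spectrum(1)[OF per V] by blast
qed

end

section \<open>Gaps and bands\<close>

text \<open>A component meeting a connected piece contains it and so is determined by any of its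
  points. If a piece is empty, its \<open>SOME\<close> term merely adds a harmless set to the
  bound.\<close>

lemma card_components_Un_connected:
  assumes "S = A \<union> B" "connected A" "connected B"
  shows "finite (components S) \<and> card (components S) \<le> 2"
proof -
  have comp: "c = connected_component_set S (SOME x. x \<in> T)"
    if c: "c \<in> components S" and T: "connected T" "T \<subseteq> S" and x: "x \<in> c" "x \<in> T" for c T x
  proof -
    have "T \<subseteq> c" by (rule components_maximal[OF c T]) (use x in blast)
    moreover have "(SOME x. x \<in> T) \<in> T" by (rule someI[of _ x]) (rule x(2))
    ultimately have "(SOME x. x \<in> T) \<in> c" by blast
    moreover obtain y where "c = connected_component_set S y" using c by (auto simp: components_iff)
    ultimately show ?thesis by (simp add: connected_component_eq)
  qed
  have sub: "components S \<subseteq> {connected_component_set S (SOME x. x \<in> A), connected_component_set S (SOME x. x \<in> B)}"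
  proof
    fix c assume c: "c \<in> components S"
    obtain x where x: "x \<in> c" using in_components_nonempty[OF c] by blast
    then have "x \<in> A \<or> x \<in> B" using in_components_subset[OF c] assms(1) by blast
    then show "c \<in> {connected_component_set S (SOME x. x \<in> A), connected_component_set S (SOME x. x \<in> B)}"
      using comp[OF c assms(2) _ x] comp[OF c assms(3) _ x] assms(1) by blast
  qed
  have "card (components S) \<le> card {connected_component_set S (SOME x. x \<in> A), connected_component_set S (SOME x. x \<in> B)}"
    by (rule card_mono[OF _ sub]) simp
  also have "\<dots> \<le> 2" by (simp add: card_insert_if)
  finally show ?thesis using finite_subset[OF sub] by simp
qed

lemma prod_list_norm_ge:
  fixes w :: complex
  assumes "0 \<le> h" "\<And>c. c \<in> set as \<Longrightarrow> h \<le> cmod (w - c)"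
  shows "h ^ length as \<le> cmod (\<Prod>c\<leftarrow>as. w - c)"
  using assms(2)
proof (induction as)
  case (Cons c as)
  have "h * h ^ length as \<le> cmod (w - c) * cmod (\<Prod>c\<leftarrow>as. w - c)"
    using Cons assms(1) by (intro mult_mono) auto
  then show ?case by (simp add: norm_mult)
qed simp

lemma prod_list_Reals:
  fixes w :: complex
  assumes "w \<in> \<real>" "\<And>c. c \<in> set as \<Longrightarrow> c \<in> \<real>"
  shows "(\<Prod>c\<leftarrow>as. w - c) \<in> \<real>"
  using assms by (induction as) auto

lemma connected_torus: "connected (sphere 0 1 \<times> sphere 0 1 :: (complex \<times> complex) set)"
  by (intro connected_Times connected_sphere) auto

lemma compact_torus: "compact (sphere 0 1 \<times> sphere 0 1 :: (complex \<times> complex) set)"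
  by (intro compact_Times compact_sphere)

section \<open>Bands as projections of the zero set of the determinant\<close>

context period
begin

definition bands :: "(int \<times> int \<Rightarrow> real) \<Rightarrow> real set" where
  "bands V = {E. \<exists>a b. cmod a = 1 \<and> cmod b = 1 \<and> bdet V a b (of_real E) = 0}"

lemma bandsI: "cmod a = 1 \<Longrightarrow> cmod b = 1 \<Longrightarrow> bdet V a b (of_real E) = 0 \<Longrightarrow> E \<in> bands V"
  unfolding bands_def by blast

lemma spectrum_H_eq_bands:
  assumes per: "periodic_pq (int p) (int q) V" and V: "\<forall>x. \<bar>V x\<bar> \<le> C"
  shows "spectrum_H V = complex_of_real ` bands V"
proof (intro Set.set_eqI iffI)
  fix z assume "z \<in> spectrum_H V"
  then obtain a b where ab: "cmod a = 1" "cmod b = 1" "bdet V a b z = 0"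
    unfolding spectrum_H_iff[OF per V] by blast
  have z: "z = of_real (Re z)" using bdet_eq_0_spectrum(2)[OF per V ab] by (simp add: complex_eq_iff)
  then have "Re z \<in> bands V" using ab by (intro bandsI[OF ab(1,2)]) simp
  then show "z \<in> complex_of_real ` bands V" using z by blast
next
  fix z assume "z \<in> complex_of_real ` bands V"
  then show "z \<in> spectrum_H V" unfolding spectrum_H_iff[OF per V] bands_def by blast
qed

lemma bands_bounded:
  assumes "periodic_pq (int p) (int q) V" "\<forall>x. \<bar>V x\<bar> \<le> C" "E \<in> bands V"
  shows "\<bar>E\<bar> \<le> 4 + C"
  using assms(3) bdet_eq_0_spectrum(3)[OF assms(1,2)] unfolding bands_def by fastforce

lemma compact_zero_set:
  "compact {x \<in> (sphere 0 1 \<times> sphere 0 1) \<times> {E1..E2}. bdet V (fst (fst x)) (snd (fst x)) (of_real (snd x)) = 0}"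
proof (rule closedin_compact)
  show "compact ((sphere 0 1 \<times> sphere 0 1) \<times> {E1..E2} :: ((complex \<times> complex) \<times> real) set)"
    by (intro compact_Times compact_torus compact_Icc compact_sphere)
  show "closedin (top_of_set ((sphere 0 1 \<times> sphere 0 1) \<times> {E1..E2}))
    {x \<in> (sphere 0 1 \<times> sphere 0 1) \<times> {E1..E2}. bdet V (fst (fst x)) (snd (fst x)) (of_real (snd x)) = 0}"
    by (intro continuous_closedin_preimage_constant continuous_on_bdet continuous_intros) auto
qed

lemma compact_bands:
  assumes "periodic_pq (int p) (int q) V" "\<forall>x. \<bar>V x\<bar> \<le> C"
  shows "compact (bands V)"
proof -
  let ?Z = "{x \<in> (sphere 0 1 \<times> sphere 0 1) \<times> {-(4+C)..4+C}. bdet V (fst (fst x)) (snd (fst x)) (of_real (snd x)) = 0}"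
  have "bands V = snd ` ?Z"
  proof (intro Set.set_eqI iffI)
    fix E assume E: "E \<in> bands V"
    then obtain a b where ab: "cmod a = 1" "cmod b = 1" "bdet V a b (of_real E) = 0" by (auto simp: bands_def)
    have "((a, b), E) \<in> ?Z" using ab bands_bounded[OF assms E] by (auto simp: abs_le_iff)
    then show "E \<in> snd ` ?Z" by (metis (no_types, lifting) image_eqI snd_conv)
  next
    fix E assume "E \<in> snd ` ?Z"
    then show "E \<in> bands V" unfolding bands_def by fastforce
  qed
  also have "compact (snd ` ?Z)"
    by (rule compact_continuous_image[OF continuous_on_snd[OF continuous_on_id] compact_zero_set])
  finally show ?thesis .
qed

lemma bdet_root_real:
  assumes "periodic_pq (int p) (int q) V" "\<forall>x. \<bar>V x\<bar> \<le> C" "cmod a = 1" "cmod b = 1"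
  shows "\<exists>as. length as = p * q \<and> (\<forall>z. bdet V a b z = (\<Prod>c\<leftarrow>as. z - c)) \<and>
    (\<forall>c\<in>set as. c \<in> \<real> \<and> bdet V a b c = 0)"
proof -
  obtain as where as: "length as = p * q" "\<And>z. bdet V a b z = (\<Prod>c\<leftarrow>as. z - c)"
    using bdet_factorized by blast
  have zero: "bdet V a b c = 0" if "c \<in> set as" for c
    unfolding as(2) prod_list_zero_iff using that by force
  have "c \<in> \<real>" if "c \<in> set as" for c
    using bdet_eq_0_spectrum(2)[OF assms zero[OF that]] by (simp add: complex_is_Real_iff)
  with as zero show ?thesis by (intro exI[of _ as]) simp
qed

lemma bdet_real:
  assumes "periodic_pq (int p) (int q) V" "\<forall>x. \<bar>V x\<bar> \<le> C" "cmod a = 1" "cmod b = 1"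
  shows "bdet V a b (of_real E) \<in> \<real>"
proof -
  obtain as where as: "length as = p * q \<and> (\<forall>z. bdet V a b z = (\<Prod>c\<leftarrow>as. z - c)) \<and>
    (\<forall>c\<in>set as. c \<in> \<real> \<and> bdet V a b c = 0)"
    using bdet_root_real[OF assms] ..
  then have eq: "bdet V a b (of_real E) = (\<Prod>c\<leftarrow>as. of_real E - c)" by blast
  show ?thesis unfolding eq by (rule prod_list_Reals) (use as in auto)
qed

text \<open>If all pq roots were at distance at least h, their product would be at least h^(pq).
  This serves as continuity of eigenvalues without ordering them.\<close>

lemma bdet_root_near:
  assumes "periodic_pq (int p) (int q) V" "\<forall>x. \<bar>V x\<bar> \<le> C" "cmod a = 1" "cmod b = 1"
    and h: "0 < h" "cmod (bdet V a b (of_real w)) < h ^ (p * q)"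
  obtains E where "\<bar>E - w\<bar> < h" "bdet V a b (of_real E) = 0"
proof -
  obtain as where as: "length as = p * q \<and> (\<forall>z. bdet V a b z = (\<Prod>c\<leftarrow>as. z - c)) \<and>
    (\<forall>c\<in>set as. c \<in> \<real> \<and> bdet V a b c = 0)"
    using bdet_root_real[OF assms(1-4)] ..
  then have eq: "bdet V a b (of_real w) = (\<Prod>c\<leftarrow>as. of_real w - c)" by blast
  have "\<exists>c\<in>set as. cmod (of_real w - c) < h"
  proof (rule ccontr)
    assume "\<not> ?thesis"
    then have "h \<le> cmod (of_real w - c)" if "c \<in> set as" for c using that by force
    then have "h ^ length as \<le> cmod (bdet V a b (of_real w))"
      unfolding eq using h(1) by (intro prod_list_norm_ge) auto
    then show False using h(2) as by simp
  qed
  then obtain c where c: "c \<in> set as" "cmod (of_real w - c) < h" by blast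
  obtain E where E: "c = of_real E" using as c(1) Reals_cases by blast
  have "cmod (of_real w - of_real E) = \<bar>E - w\<bar>" by (metis abs_minus_commute norm_of_real of_real_diff)
  then show thesis using that[of E] as c unfolding E by simp
qed

text \<open>The set of quasimomenta at which some eigenvalue lies between two energies outside the bands is open
  and closed in the torus.\<close>

lemma bands_gap:
  assumes per: "periodic_pq (int p) (int q) V" and V: "\<forall>x. \<bar>V x\<bar> \<le> C"
    and E: "E1 \<notin> bands V" "E2 \<notin> bands V"
    and s: "cmod a = 1" "cmod b = 1" "\<And>E. E1 \<le> E \<Longrightarrow> E \<le> E2 \<Longrightarrow> bdet V a b (of_real E) \<noteq> 0"
    and x: "E1 \<le> x" "x \<le> E2"
  shows "x \<notin> bands V"
proof -
  let ?T = "sphere 0 1 \<times> sphere 0 1 :: (complex \<times> complex) set"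
  let ?Z = "{x \<in> ?T \<times> {E1..E2}. bdet V (fst (fst x)) (snd (fst x)) (of_real (snd x)) = 0}"
  let ?O = "fst ` ?Z"
  have OT: "?O \<subseteq> ?T" by auto
  have Oiff: "s \<in> ?O \<longleftrightarrow> s \<in> ?T \<and> (\<exists>E\<in>{E1..E2}. bdet V (fst s) (snd s) (of_real E) = 0)" for s
    by force
  have "closed ?O"
    by (rule compact_imp_closed[OF compact_continuous_image[OF continuous_on_fst[OF continuous_on_id] compact_zero_set]])
  then have cl: "closedin (top_of_set ?T) ?O" using OT by (rule closed_subset[rotated])
  have op: "openin (top_of_set ?T) ?O"
  proof (subst openin_subopen, rule ballI)
    fix s0 assume s0: "s0 \<in> ?O"
    then obtain w where w: "w \<in> {E1..E2}" "bdet V (fst s0) (snd s0) (of_real w) = 0" and s0T: "s0 \<in> ?T"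
      unfolding Oiff by blast
    have "w \<in> bands V" using w(2) s0T by (intro bandsI[of "fst s0" "snd s0"]) auto
    then have "w \<noteq> E1" "w \<noteq> E2" using E by auto
    then have w12: "E1 < w" "w < E2" using w(1) by auto
    \<comment> \<open>The ends are outside the bands, so w is interior; roots within h of w stay
      between E1 and E2, which makes the set open.\<close>
    define h where "h = min (w - E1) (E2 - w)"
    have h: "0 < h" "h \<le> w - E1" "h \<le> E2 - w" using w12 by (auto simp: h_def)
    define g where "g s = cmod (bdet V (fst s) (snd s) (of_real w))" for s
    define U where "U = ?T \<inter> g -` {..<h ^ (p * q)}"
    have "continuous_on ?T g" unfolding g_def by (intro continuous_intros continuous_on_bdet) auto
    then have "openin (top_of_set ?T) U" unfolding U_def by (rule continuous_openin_preimage_gen) simp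
    moreover have "s0 \<in> U" using s0T w(2) h(1) by (simp add: U_def g_def)
    moreover have "U \<subseteq> ?O"
    proof
      fix s assume "s \<in> U"
      then have sT: "s \<in> ?T" and gs: "g s < h ^ (p * q)" by (auto simp: U_def)
      have n: "cmod (fst s) = 1" "cmod (snd s) = 1" using sT by auto
      obtain E where "\<bar>E - w\<bar> < h" "bdet V (fst s) (snd s) (of_real E) = 0"
        using bdet_root_near[OF per V n h(1), of w] gs unfolding g_def by blast
      then show "s \<in> ?O" unfolding Oiff using sT h by (intro conjI bexI[of _ E]) auto
    qed
    ultimately show "\<exists>T. openin (top_of_set ?T) T \<and> s0 \<in> T \<and> T \<subseteq> ?O" by blast
  qed
  have "?O = {} \<or> ?O = ?T"
    using connected_torus cl op unfolding connected_clopen by blast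
  moreover have "(a, b) \<in> ?T" "(a, b) \<notin> ?O" using s unfolding Oiff by auto
  ultimately have O: "?O = {}" by blast
  show ?thesis
  proof
    assume "x \<in> bands V"
    then obtain a b where "cmod a = 1" "cmod b = 1" "bdet V a b (of_real x) = 0" by (auto simp: bands_def)
    then have "(a, b) \<in> ?O" unfolding Oiff using x by auto
    then show False using O by blast
  qed
qed

text \<open>The intermediate value theorem on the torus gives a zero of the real part, and the
  determinant is real there.\<close>

lemma bands_sign_change:
  assumes per: "periodic_pq (int p) (int q) V" and V: "\<forall>x. \<bar>V x\<bar> \<le> C"
    and ab: "cmod a = 1" "cmod b = 1" "cmod a' = 1" "cmod b' = 1"
    and sign: "Re (bdet V a b (of_real E)) < 0" "0 < Re (bdet V a' b' (of_real E))"
  shows "E \<in> bands V"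
proof -
  let ?T = "sphere 0 1 \<times> sphere 0 1 :: (complex \<times> complex) set"
  let ?f = "\<lambda>s. Re (bdet V (fst s) (snd s) (of_real E))"
  have "continuous_on ?T ?f" by (intro continuous_intros continuous_on_bdet) auto
  then have "connected (?f ` ?T)" by (rule connected_continuous_image[OF _ connected_torus])
  moreover have "?f (a, b) \<in> ?f ` ?T" "?f (a', b') \<in> ?f ` ?T" by (rule imageI; simp add: ab)+
  moreover have "?f (a, b) \<le> 0" "0 \<le> ?f (a', b')" using sign by simp_all
  ultimately have "0 \<in> ?f ` ?T" by (rule connectedD_interval)
  then obtain s where s: "s \<in> ?T" "?f s = 0" by auto
  have n: "cmod (fst s) = 1" "cmod (snd s) = 1" using s(1) by auto
  have "bdet V (fst s) (snd s) (of_real E) = 0"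
    using s(2) bdet_real[OF per V n, of E] by (simp add: complex_is_Real_iff complex_eq_iff)
  then show ?thesis by (rule bandsI[OF n])
qed

lemma bands_stable:
  assumes E0: "-4 < E0" "E0 < 4" "E0 \<noteq> 0 \<or> odd p \<or> odd q"
  shows "\<exists>d>0. \<forall>V E. periodic_pq (int p) (int q) V \<longrightarrow> (\<forall>x. \<bar>V x\<bar> \<le> d) \<longrightarrow> \<bar>E - E0\<bar> \<le> d \<longrightarrow> E \<in> bands V"
proof -
  obtain x y x' y' where xy: "free_prod p q E0 x y < 0" "0 < free_prod p q E0 x' y'"
    using free_prod_sign_change_nonzero[OF p_pos q_pos E0(1,2)] free_prod_sign_change_zero[OF p_pos q_pos] E0(3)
    by blast
  let ?a = "\<lambda>x. cis (real p * x)" and ?b = "\<lambda>y. cis (real q * y)"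
  \<comment> \<open>The tolerance is the modulus of the free value, so the perturbed determinant
    keeps its sign.\<close>
  have "0 < - free_prod p q E0 x y" using xy by simp
  from bdet_close[OF this, of E0 "?a x" "?b y"]
  obtain d1 where d1: "0 < d1" "\<And>V E. (\<forall>x. \<bar>V x\<bar> \<le> d1) \<Longrightarrow> \<bar>E - E0\<bar> \<le> d1 \<Longrightarrow>
     cmod (bdet V (?a x) (?b y) (of_real E) - of_real (free_prod p q E0 x y)) < - free_prod p q E0 x y"
    unfolding bdet_free by blast
  from bdet_close[OF xy(2), of E0 "?a x'" "?b y'"]
  obtain d2 where d2: "0 < d2" "\<And>V E. (\<forall>x. \<bar>V x\<bar> \<le> d2) \<Longrightarrow> \<bar>E - E0\<bar> \<le> d2 \<Longrightarrow>
     cmod (bdet V (?a x') (?b y') (of_real E) - of_real (free_prod p q E0 x' y')) < free_prod p q E0 x' y'"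
    unfolding bdet_free by blast
  have "E \<in> bands V" if per: "periodic_pq (int p) (int q) V" and V: "\<forall>x. \<bar>V x\<bar> \<le> min d1 d2"
    and E: "\<bar>E - E0\<bar> \<le> min d1 d2" for V E
  proof (rule bands_sign_change[OF per V])
    have 1: "\<forall>x. \<bar>V x\<bar> \<le> d1" "\<bar>E - E0\<bar> \<le> d1" and 2: "\<forall>x. \<bar>V x\<bar> \<le> d2" "\<bar>E - E0\<bar> \<le> d2"
      using V E by auto
    show "Re (bdet V (?a x) (?b y) (of_real E)) < 0"
      using le_less_trans[OF abs_Re_le_cmod d1(2)[OF 1]] by simp
    show "0 < Re (bdet V (?a x') (?b y') (of_real E))"
      using le_less_trans[OF abs_Re_le_cmod d2(2)[OF 2]] by simp
  qed auto
  then show ?thesis using d1(1) d2(1) by (intro exI[of _ "min d1 d2"]) auto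
qed

text \<open>The free product is nonzero somewhere at every energy, and at that quasimomentum the
  perturbed determinant stays nonzero on a whole window around E0; \<open>bands_gap\<close> applies
  to that window.\<close>

lemma bands_local_gap:
  "\<exists>d>0. \<forall>V E1 E2 x. periodic_pq (int p) (int q) V \<longrightarrow> (\<forall>x. \<bar>V x\<bar> \<le> d) \<longrightarrow> E0 - d \<le> E1 \<longrightarrow> E1 \<le> x \<longrightarrow> x \<le> E2 \<longrightarrow> E2 \<le> E0 + d
      \<longrightarrow> E1 \<notin> bands V \<longrightarrow> E2 \<notin> bands V \<longrightarrow> x \<notin> bands V"
proof -
  obtain x y where xy: "free_prod p q E0 x y \<noteq> 0" using free_prod_nonzero by blast
  let ?a = "cis (real p * x)" and ?b = "cis (real q * y)"
  have "0 < \<bar>free_prod p q E0 x y\<bar>" using xy by simp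
  from bdet_close[OF this, of E0 "?a" "?b"]
  obtain d where d: "0 < d" "\<And>V E. (\<forall>x. \<bar>V x\<bar> \<le> d) \<Longrightarrow> \<bar>E - E0\<bar> \<le> d \<Longrightarrow>
     cmod (bdet V ?a ?b (of_real E) - of_real (free_prod p q E0 x y)) < \<bar>free_prod p q E0 x y\<bar>"
    unfolding bdet_free by blast
  have "w \<notin> bands V" if per: "periodic_pq (int p) (int q) V" and V: "\<forall>x. \<bar>V x\<bar> \<le> d"
    and E: "E0 - d \<le> E1" "E1 \<le> w" "w \<le> E2" "E2 \<le> E0 + d" "E1 \<notin> bands V" "E2 \<notin> bands V" for V E1 E2 w
  proof (rule bands_gap[OF per V E(5,6) _ _ _ E(2,3)])
    fix E assume "E1 \<le> E" "E \<le> E2"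
    then have "\<bar>E - E0\<bar> \<le> d" using E by linarith
    from d(2)[OF V this] show "bdet V ?a ?b (of_real E) \<noteq> 0" by auto
  qed auto
  then show ?thesis using d(1) by blast
qed

lemma bands_stable_compact:
  assumes K: "compact K" "\<And>E. E \<in> K \<Longrightarrow> -4 < E \<and> E < 4 \<and> (E \<noteq> 0 \<or> odd p \<or> odd q)"
  shows "\<exists>d>0. \<forall>V. periodic_pq (int p) (int q) V \<longrightarrow> (\<forall>x. \<bar>V x\<bar> \<le> d) \<longrightarrow> K \<subseteq> bands V"
proof -
  have "\<forall>E0\<in>K. \<exists>d>0. \<forall>V E. periodic_pq (int p) (int q) V \<longrightarrow> (\<forall>x. \<bar>V x\<bar> \<le> d) \<longrightarrow> \<bar>E - E0\<bar> \<le> d \<longrightarrow> E \<in> bands V"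
    using K(2) bands_stable by blast
  then obtain d where d: "\<And>E0. E0 \<in> K \<Longrightarrow> 0 < d E0" "\<And>E0 V E. E0 \<in> K \<Longrightarrow> periodic_pq (int p) (int q) V \<Longrightarrow>
      (\<forall>x. \<bar>V x\<bar> \<le> d E0) \<Longrightarrow> \<bar>E - E0\<bar> \<le> d E0 \<Longrightarrow> E \<in> bands V"
    by metis
  have "K \<subseteq> (\<Union>E0\<in>K. ball E0 (d E0))" using d(1) by force
  then obtain F where F: "F \<subseteq> K" "finite F" "K \<subseteq> (\<Union>E0\<in>F. ball E0 (d E0))"
    using compactE_image[OF K(1), of K "\<lambda>E0. ball E0 (d E0)"] by auto
  \<comment> \<open>\<open>insert 1\<close> provides a minimum even if the subcover is
    empty.\<close>
  define m where "m = Min (insert 1 (d ` F))"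
  have "0 < m" unfolding m_def using F d(1) by (subst Min_gr_iff) auto
  moreover have "K \<subseteq> bands V" if per: "periodic_pq (int p) (int q) V" and V: "\<forall>x. \<bar>V x\<bar> \<le> m" for V
  proof
    fix E assume "E \<in> K"
    then obtain E0 where E0: "E0 \<in> F" "dist E0 E < d E0" using F(3) by auto
    have "m \<le> d E0" unfolding m_def using E0(1) F(2) by (intro Min_le) auto
    then have "\<forall>x. \<bar>V x\<bar> \<le> d E0" using V order_trans by blast
    then show "E \<in> bands V" using d(2)[OF _ per, of E0 E] E0 F(1) by (auto simp: dist_real_def)
  qed
  ultimately show ?thesis by blast
qed

lemma bands_structure:
  "\<exists>C>0. \<forall>V. periodic_pq (int p) (int q) V \<longrightarrow> (\<forall>x. \<bar>V x\<bar> \<le> C) \<longrightarrow>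
     bands V \<noteq> {} \<and> (\<exists>j. connected (bands V \<inter> {..j}) \<and> connected (bands V \<inter> {j..})) \<and>
     (odd p \<or> odd q \<longrightarrow> connected (bands V))"
proof -
  have "\<exists>d. \<forall>E0. 0 < d E0 \<and> (\<forall>V E1 E2 x. periodic_pq (int p) (int q) V \<longrightarrow> (\<forall>x. \<bar>V x\<bar> \<le> d E0) \<longrightarrow> E0 - d E0 \<le> E1
      \<longrightarrow> E1 \<le> x \<longrightarrow> x \<le> E2 \<longrightarrow> E2 \<le> E0 + d E0 \<longrightarrow> E1 \<notin> bands V \<longrightarrow> E2 \<notin> bands V \<longrightarrow> x \<notin> bands V)"
    by (intro choice allI) (rule bands_local_gap)
  then obtain dd where dd: "\<And>E0. 0 < dd E0" "\<And>E0 V E1 E2 x. periodic_pq (int p) (int q) V \<Longrightarrow> (\<forall>x. \<bar>V x\<bar> \<le> dd E0) \<Longrightarrow>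
      E0 - dd E0 \<le> E1 \<Longrightarrow> E1 \<le> x \<Longrightarrow> x \<le> E2 \<Longrightarrow> E2 \<le> E0 + dd E0 \<Longrightarrow> E1 \<notin> bands V \<Longrightarrow> E2 \<notin> bands V \<Longrightarrow> x \<notin> bands V"
    by blast
  \<comment> \<open>The bound 1 places the energy 2 in \<open>K\<close>, which later shows that the
    bands are nonempty.\<close>
  define d where "d = min 1 (min (dd (-4)) (min (dd 0) (dd 4)))"
  have d: "0 < d" "d \<le> 1" "d \<le> dd (-4)" "d \<le> dd 0" "d \<le> dd 4" using dd(1) by (auto simp: d_def)
  let ?odd = "odd p \<or> odd q"
  define K where "K = {-4 + d..4 - d} - (if ?odd then {} else {-d<..<d})"
  have "compact K" unfolding K_def by (intro compact_diff compact_Icc) auto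
  moreover have "-4 < E \<and> E < 4 \<and> (E \<noteq> 0 \<or> odd p \<or> odd q)" if "E \<in> K" for E
    using that d(1) by (auto simp: K_def split: if_splits)
  ultimately obtain dK where dK: "0 < dK"
    "\<And>V. periodic_pq (int p) (int q) V \<Longrightarrow> (\<forall>x. \<bar>V x\<bar> \<le> dK) \<Longrightarrow> K \<subseteq> bands V"
    using bands_stable_compact by blast
  \<comment> \<open>C < d puts 4 + d and -4 - d outside the bands, yet inside the windows around 4
    and -4.\<close>
  define C where "C = min dK (d / 2)"
  have C: "0 < C" "C \<le> dK" "C < d" using dK(1) d(1) by (auto simp: C_def min_def)
  have "bands V \<noteq> {} \<and> (\<exists>j. connected (bands V \<inter> {..j}) \<and> connected (bands V \<inter> {j..})) \<and>
     (?odd \<longrightarrow> connected (bands V))" if per: "periodic_pq (int p) (int q) V" and V: "\<forall>x. \<bar>V x\<bar> \<le> C" for V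
  proof -
    have VK: "\<forall>x. \<bar>V x\<bar> \<le> dK" using V C(2) order_trans by blast
    have Vd: "\<forall>x. \<bar>V x\<bar> \<le> dd E0" if "d \<le> dd E0" for E0
      using V C(3) that by (meson less_imp_le order_trans)
    note K = dK(2)[OF per VK]
    have bd: "\<bar>E\<bar> \<le> 4 + C" if "E \<in> bands V" for E by (rule bands_bounded[OF per V that])
    \<comment> \<open>E and 4 + d are both outside the bands, so convexity empties everything
      between them: a missing energy near 4 belongs to the exterior.\<close>
    have top: "E < x \<Longrightarrow> x \<notin> bands V" if E: "E \<notin> bands V" "4 - d \<le> E" for E x
    proof
      assume x: "E < x" "x \<in> bands V"
      have "4 + d \<notin> bands V" using bd[of "4 + d"] C d by auto
      moreover have "x \<le> 4 + d" using bd[OF x(2)] C by linarith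
      ultimately have "x \<notin> bands V"
        using dd(2)[OF per Vd[OF d(5)], of E x "4 + d"] E x d by auto
      then show False using x by blast
    qed
    have bot: "x < E \<Longrightarrow> x \<notin> bands V" if E: "E \<notin> bands V" "E \<le> -4 + d" for E x
    proof
      assume x: "x < E" "x \<in> bands V"
      have "-4 - d \<notin> bands V" using bd[of "-4 - d"] C d by auto
      moreover have "-4 - d \<le> x" using bd[OF x(2)] C by linarith
      ultimately have "x \<notin> bands V"
        using dd(2)[OF per Vd[OF d(3)], of "-4 - d" x E] E x d by auto
      then show False using x by blast
    qed
    have mid: "y \<notin> bands V" if "x \<notin> bands V" "z \<notin> bands V" "-d \<le> x" "x \<le> y" "y \<le> z" "z \<le> d" for x y z
      using dd(2)[OF per Vd[OF d(4)], of x y z] that d by auto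
    \<comment> \<open>A missing energy between two band energies avoids \<open>K\<close> and, by
      \<open>top\<close> and \<open>bot\<close>, the neighbourhoods of 4 and -4; only the window
      around 0 is left, which is cut out of \<open>K\<close> only for even periods.\<close>
    have gap: "\<not> ?odd \<and> -d < y \<and> y < d" if "y \<notin> bands V" "x \<in> bands V" "z \<in> bands V" "x \<le> y" "y \<le> z" for x y z
    proof -
      have "x < y" "y < z" using that by (metis order_le_less)+
      then have "y \<in> {-4 + d..4 - d}" using top[OF that(1), of z] bot[OF that(1), of x] that by force
      moreover have "y \<notin> K" using K that(1) by blast
      ultimately show ?thesis by (auto simp: K_def split: if_splits)
    qed
    have con: "connected (bands V)" if "?odd"
      using gap that by (intro connectedI_interval) blast
    have ne: "bands V \<noteq> {}"
    proof -
      have "2 \<in> K" using d by (auto simp: K_def)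
      then show ?thesis using K by blast
    qed
    have "\<exists>j. connected (bands V \<inter> {..j}) \<and> connected (bands V \<inter> {j..})"
    \<comment> \<open>Split at a missing energy j near 0. By \<open>mid\<close> any other missing
      energy in this window lies in the same gap as j, so neither side has a further gap.\<close>
    proof (cases "\<exists>j. j \<notin> bands V \<and> -d < j \<and> j < d")
      case True
      then obtain j where j: "j \<notin> bands V" "-d < j" "j < d" by blast
      have "connected (bands V \<inter> {..j})"
      proof (rule connectedI_interval)
        fix x z y assume xyz: "x \<in> bands V \<inter> {..j}" "z \<in> bands V \<inter> {..j}" "x \<le> y" "y \<le> z"
        have "y \<in> bands V"
        proof (rule ccontr)
          assume y: "y \<notin> bands V"
          have "-d < y" using gap[OF y, of x z] xyz by blast
          then show False using mid[OF y j(1), of z] xyz j by auto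
        qed
        then show "y \<in> bands V \<inter> {..j}" using xyz by auto
      qed
      moreover have "connected (bands V \<inter> {j..})"
      proof (rule connectedI_interval)
        fix x z y assume xyz: "x \<in> bands V \<inter> {j..}" "z \<in> bands V \<inter> {j..}" "x \<le> y" "y \<le> z"
        have "y \<in> bands V"
        proof (rule ccontr)
          assume y: "y \<notin> bands V"
          have "y < d" using gap[OF y, of x z] xyz by blast
          then show False using mid[OF j(1) y, of x] xyz j by auto
        qed
        then show "y \<in> bands V \<inter> {j..}" using xyz by auto
      qed
      ultimately show ?thesis by blast
    next
      \<comment> \<open>Here \<open>gap\<close> leaves no gap at all, so every j works.\<close>
      case False
      have "connected (bands V \<inter> {..j})" "connected (bands V \<inter> {j..})" for j
        by (rule connectedI_interval; use gap False in force)+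
      then show ?thesis by blast
    qed
    with ne con show ?thesis by blast
  qed
  then show ?thesis using C(1) by blast
qed

end

theorem theorem1p1:
  fixes p q :: int
  assumes "p > 0" and "q > 0"
  shows "\<exists>C>0.
    (\<forall>V. periodic_pq p q V \<and> (\<forall>x. \<bar>V x\<bar> \<le> C) \<longrightarrow>
         finite (components (spectrum_H V)) \<and> card (components (spectrum_H V)) \<le> 2) \<and>
    ((odd p \<or> odd q) \<longrightarrow>
       (\<forall>V. periodic_pq p q V \<and> (\<forall>x. \<bar>V x\<bar> \<le> C) \<longrightarrow>
         (\<exists>a b::real. a \<le> b \<and> spectrum_H V = complex_of_real ` {a..b})))"
proof -
  interpret period "nat p" "nat q" by unfold_locales (use assms in auto)
  have pq: "int (nat p) = p" "int (nat q) = q" using assms by auto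
  have parity: "odd (nat p) \<longleftrightarrow> odd p" "odd (nat q) \<longleftrightarrow> odd q"
    using assms by (simp_all add: even_nat_iff)
  obtain C where C: "0 < C" "\<And>V. periodic_pq p q V \<Longrightarrow> (\<forall>x. \<bar>V x\<bar> \<le> C) \<Longrightarrow>
     bands V \<noteq> {} \<and> (\<exists>j. connected (bands V \<inter> {..j}) \<and> connected (bands V \<inter> {j..})) \<and>
     (odd p \<or> odd q \<longrightarrow> connected (bands V))"
    using bands_structure unfolding pq parity by blast
  have sp: "spectrum_H V = complex_of_real ` bands V" if "periodic_pq p q V" "\<forall>x. \<bar>V x\<bar> \<le> C" for V
    by (rule spectrum_H_eq_bands[unfolded pq, OF that])
  have two: "finite (components (spectrum_H V)) \<and> card (components (spectrum_H V)) \<le> 2"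
    if V: "periodic_pq p q V" "\<forall>x. \<bar>V x\<bar> \<le> C" for V
  proof -
    obtain j where j: "connected (bands V \<inter> {..j})" "connected (bands V \<inter> {j..})"
      using C(2)[OF V] by blast
    have "spectrum_H V = complex_of_real ` (bands V \<inter> {..j}) \<union> complex_of_real ` (bands V \<inter> {j..})"
      unfolding sp[OF V] by force
    moreover have "connected (complex_of_real ` (bands V \<inter> {..j}))" "connected (complex_of_real ` (bands V \<inter> {j..}))"
      by (intro connected_continuous_image continuous_on_of_real continuous_on_id j)+
    ultimately show ?thesis by (rule card_components_Un_connected)
  qed
  have one: "\<exists>a b. a \<le> b \<and> spectrum_H V = complex_of_real ` {a..b}"
    if odd: "odd p \<or> odd q" and V: "periodic_pq p q V" "\<forall>x. \<bar>V x\<bar> \<le> C" for V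
  proof -
    have "connected (bands V)" "bands V \<noteq> {}" using C(2)[OF V] odd by blast+
    moreover have "compact (bands V)" by (rule compact_bands[unfolded pq, OF V])
    ultimately obtain a b where "bands V = {a..b}" "a \<le> b"
      using connected_compact_interval_1[of "bands V"] by auto
    then show ?thesis unfolding sp[OF V] by blast
  qed
  show ?thesis using C(1) two one by blast
qed

end
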